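(* Let $F=(f_1,\ldots,f_m):\mathcal{M}\to\mathbb{R}^m$ be continuously differentiable with $\nabla F$ componentwise Lipschitz continuous on $\mathcal{M}$ with constant $L>0$, and let $\{p_k\}$ be an infinite sequence generated by the steepest descent algorithm with any one of Strategies 1, 2 or 3 (described in the context). Set $f_i^*:=\inf\{f_i(q): q\in\mathcal{M}\}$ for $i\in\mathcal{I}=\{1,\ldots,m\}$. Suppose that $f_i^*>-\infty$ for some $i\in\mathcal{I}$, and let $i_*\in\mathcal{I}$ be such that $$f_{i_*}(p_0)-f_{i_*}^*=\min\{f_i(p_0)-f_i^*: i\in\mathcal{I}\}.$$ Then, for every integer $N\ge1$, $$\min\{\|v_k\|: k=0,1,\ldots,N-1\}\le\left[\frac{f_{i_*}(p_0)-f_{i_*}^*}{\nu\xi}\right]^{1/2}\frac{1}{\sqrt N},$$ where $\nu=1/2$ and $\xi=\varepsilon$ for Strategy 1, $\nu=\zeta$ and $\xi=\eta/L$ for Strategy 2, and $\nu=\delta$ and $\xi=t_{\min}$ for Strategy 3.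
   Context: Setting: $\mathcal{M}$ is a connected, finite-dimensional, complete Riemannian manifold with metric $\langle\cdot,\cdot\rangle$, norm $\|\cdot\|$ and exponential map $\exp$. $e=(1,\ldots,1)\in\mathbb{R}^m$. For $x,y\in\mathbb{R}^m$, $x\preceq y$ means $y-x\in\mathbb{R}^m_+$ (coordinatewise $\le$). For $p,q\in\mathcal{M}$, $\Gamma_{pq}$ is the set of all (not necessarily minimal) geodesic segments $\gamma:[0,1]\to\mathcal{M}$ with $\gamma(0)=p$, $\gamma(1)=q$; $\ell(\gamma)$ is the length and $P_{\gamma,p,q}$ is parallel transport along $\gamma$ from $p$ to $q$. $\nabla F$ is componentwise Lipschitz continuous with constant $L$ if for each $i$ there is $L_i\ge0$ with $\|P_{\gamma,p,q}\operatorname{grad} f_i(p)-\operatorname{grad} f_i(q)\|\le L_i\ell(\gamma)$ for all $p,q\in\mathcal{M}$, $\gamma\in\Gamma_{pq}$, and $L=\max_i L_i$. Steepest descent direction: $v_p:=\operatorname{argmin}_{v\in T_p\mathcal{M}}\{\max_{i\in\mathcal{I}}\langle\operatorname{grad} f_i(p),v\rangle+\tfrac12\|v\|^2\}$. Algorithm: given $p_0\in\mathcal{M}$, for $k=0,1,\ldots$ put $v_k:=v_{p_k}$; stop if $v_k=0$; otherwise choose a stepsize $t_k>0$ and set $p_{k+1}:=\exp_{p_k}(t_kv_k)$. It is assumed that $v_k\ne0$ for all $k$, so the sequence is infinite. Stepsize rules: Strategy 1 (Lipschitz stepsize): $\varepsilon>0$ is fixed and $\varepsilon<t_k\le 1/L$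 for all $k$. Strategy 2 (adaptive stepsize): fix $\zeta\in(0,1/2]$, $L_0>0$ with $L_0\le L$, $0<\eta<1$, $t_{-1}:=L_0^{-1}$, and for $k\ge0$ set $t_k:=\eta^{i_k}t_{k-1}$, where $i_k$ is the smallest integer $i\ge0$ with $F(\exp_{p_k}(\eta^i t_{k-1}v_k))\preceq F(p_k)-\zeta\eta^i t_{k-1}\|v_k\|^2e$. Strategy 3 (Armijo-type stepsize): fix $t_{\max}>t_{\min}>0$, $0<\omega_1<\omega_2<1$, $\delta\in(0,1)$, with $t_{\max}>2(1-\delta)/L$ and $t_{\min}<2\omega_1(1-\delta)/L$. For each $k$ take a trial $\hat t_{k_0}\in[t_{\min},t_{\max}]$ and, for $\ell=0,1,\ldots$: if $F(\exp_{p_k}(\hat t_{k_\ell}v_k))\preceq F(p_k)-\delta\hat t_{k_\ell}\|v_k\|^2e$, set $t_k:=\hat t_{k_\ell}$ and stop; otherwise choose $\hat t_{k_{\ell+1}}\in[\omega_1\hat t_{k_\ell},\omega_2\hat t_{k_\ell}]$ and continue. Standing assumption: the set $\mathcal{A}:=\{p\in\mathcal{M}: F(p)\preceq F(p_k),\ k=0,1,\ldots\}$ is nonempty. *)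

theory Defs
  imports "HOL-Analysis.Analysis"
begin

text \<open>
  A manifold of dimension \<open>DIM('e)\<close> is carried by a whole type \<open>'a\<close> and given by an atlas of
  charts with values in \<open>'e\<close>. As part of the data every point has a preferred chart of the atlas,
  and a tangent vector at \<open>p\<close> is represented by its coordinate vector in the preferred chart
  at \<open>p\<close>. Thus every tangent space is a copy of the vector space \<open>'e\<close>, and \<open>rmetric\<close> gives the
  inner product on it.
\<close>

record ('a, 'e) chart =
  chart_dom :: "'a set"
  chart_map :: "'a \<Rightarrow> 'e"

record ('a, 'e) riem_structure =
  atlas :: "('a, 'e) chart set"
  chart_at :: "'a \<Rightarrow> ('a, 'e) chart"
  rmetric :: "'a \<Rightarrow> 'e \<Rightarrow> 'e \<Rightarrow> real"

definition chart_inv :: "('a, 'e) chart \<Rightarrow> 'e \<Rightarrow> 'a" where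
  "chart_inv c = inv_into (chart_dom c) (chart_map c)"

definition chart_image :: "('a, 'e) chart \<Rightarrow> 'e set" where
  "chart_image c = chart_map c ` chart_dom c"

definition is_chart ::
    "('a::topological_space, 'e::euclidean_space) chart \<Rightarrow> bool" where
  "is_chart c \<longleftrightarrow> open (chart_dom c) \<and> open (chart_image c) \<and>
     homeomorphism (chart_dom c) (chart_image c) (chart_map c) (chart_inv c)"

text \<open>Continuous differentiability of order \<open>k\<close>; intended for open sets \<open>S\<close> only.\<close>

primrec ck_on ::
    "nat \<Rightarrow> 'a::euclidean_space set \<Rightarrow> ('a \<Rightarrow> 'b::real_normed_vector) \<Rightarrow> bool" where
  "ck_on 0 S f \<longleftrightarrow> continuous_on S f"
| "ck_on (Suc k) S f \<longleftrightarrow> (\<forall>x\<in>S. f differentiable (at x)) \<and>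
     (\<forall>v. ck_on k S (\<lambda>x. frechet_derivative f (at x) v))"

definition smooth_on ::
    "'a::euclidean_space set \<Rightarrow> ('a \<Rightarrow> 'b::real_normed_vector) \<Rightarrow> bool" where
  "smooth_on S f \<longleftrightarrow> (\<forall>k. ck_on k S f)"

definition transition :: "('a, 'e) chart \<Rightarrow> ('a, 'e) chart \<Rightarrow> 'e \<Rightarrow> 'e" where
  "transition c d = chart_map d \<circ> chart_inv c"

text \<open>Passage from the coordinates in \<open>c\<close> of a tangent vector at \<open>p\<close> to those in \<open>d\<close>.\<close>

definition tangent_change ::
    "('a, 'e::euclidean_space) chart \<Rightarrow> ('a, 'e) chart \<Rightarrow> 'a \<Rightarrow> 'e \<Rightarrow> 'e" where
  "tangent_change c d p = frechet_derivative (transition c d) (at (chart_map c p))"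

text \<open>The coefficients of the metric in the chart \<open>c\<close>, as a function of the coordinates \<open>x\<close>.\<close>

definition metric_in_chart ::
    "('a, 'e::euclidean_space) riem_structure \<Rightarrow> ('a, 'e) chart \<Rightarrow> 'e \<Rightarrow> 'e \<Rightarrow> 'e \<Rightarrow> real" where
  "metric_in_chart M c x u v =
     (let p = chart_inv c x
      in rmetric M p (tangent_change c (chart_at M p) p u) (tangent_change c (chart_at M p) p v))"

definition riemannian_manifold ::
    "('a::{t2_space, second_countable_topology}, 'e::euclidean_space) riem_structure \<Rightarrow> bool" where
  "riemannian_manifold M \<longleftrightarrow>
     (\<forall>c\<in>atlas M. is_chart c) \<and>
     (\<forall>p. chart_at M p \<in> atlas M \<and> p \<in> chart_dom (chart_at M p)) \<and>
     (\<forall>c\<in>atlas M. \<forall>d\<in>atlas M.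
        smooth_on (chart_map c ` (chart_dom c \<inter> chart_dom d)) (transition c d)) \<and>
     (\<forall>p. bilinear (rmetric M p) \<and> (\<forall>u v. rmetric M p u v = rmetric M p v u) \<and>
        (\<forall>v. v \<noteq> 0 \<longrightarrow> 0 < rmetric M p v v)) \<and>
     (\<forall>c\<in>atlas M. \<forall>u v. smooth_on (chart_image c) (\<lambda>x. metric_in_chart M c x u v))"

definition rnorm :: "('a, 'e::euclidean_space) riem_structure \<Rightarrow> 'a \<Rightarrow> 'e \<Rightarrow> real" where
  "rnorm M p v = sqrt (rmetric M p v v)"

text \<open>
  The Christoffel symbols of the Levi-Civita connection in the chart \<open>c\<close>, as a bilinear map:
  \<open>christoffel M c x u v\<close> is the coordinate vector with components
  \<open>\<Sum>i j. \<Gamma>\<^sup>k\<^sub>i\<^sub>j u\<^sub>i v\<^sub>j\<close>, characterised by the Koszul formula for constant coordinate fields.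
\<close>

definition christoffel ::
    "('a, 'e::euclidean_space) riem_structure \<Rightarrow> ('a, 'e) chart \<Rightarrow> 'e \<Rightarrow> 'e \<Rightarrow> 'e \<Rightarrow> 'e" where
  "christoffel M c x u v = (THE z. \<forall>w. metric_in_chart M c x z w =
     (frechet_derivative (\<lambda>y. metric_in_chart M c y v w) (at x) u
      + frechet_derivative (\<lambda>y. metric_in_chart M c y u w) (at x) v
      - frechet_derivative (\<lambda>y. metric_in_chart M c y u v) (at x) w) / 2)"

text \<open>
  Curves are functions on the reals of which only the values on the parameter interval \<open>S\<close>
  matter; derivatives at end points of \<open>S\<close> are one-sided.
\<close>

definition velocity ::
    "('a, 'e::euclidean_space) riem_structure \<Rightarrow> real set \<Rightarrow> (real \<Rightarrow> 'a) \<Rightarrow> real \<Rightarrow> 'e" where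
  "velocity M S \<gamma> t = vector_derivative (chart_map (chart_at M (\<gamma> t)) \<circ> \<gamma>) (at t within S)"

text \<open>
  A vector field along \<open>\<gamma>\<close> assigns to \<open>s\<close> a vector \<open>X s\<close> in the tangent space at \<open>\<gamma> s\<close>, hence in
  coordinates of the preferred chart at \<open>\<gamma> s\<close>. Its covariant derivative at \<open>t\<close> is \<open>X' + \<Gamma>(\<gamma>', X)\<close>,
  computed in the one chart preferred at \<open>\<gamma> t\<close>, to which all the nearby vectors \<open>X s\<close> have to be
  converted first.
\<close>

definition has_covariant_derivative ::
    "('a, 'e::euclidean_space) riem_structure \<Rightarrow> real set \<Rightarrow> (real \<Rightarrow> 'a) \<Rightarrow> (real \<Rightarrow> 'e) \<Rightarrow>
      'e \<Rightarrow> real \<Rightarrow> bool" where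
  "has_covariant_derivative M S \<gamma> X Y t \<longleftrightarrow>
     (let c = chart_at M (\<gamma> t)
      in ((\<lambda>s. tangent_change (chart_at M (\<gamma> s)) c (\<gamma> s) (X s)) has_vector_derivative
            (Y - christoffel M c (chart_map c (\<gamma> t)) (velocity M S \<gamma> t) (X t)))
          (at t within S))"

definition parallel_along ::
    "('a, 'e::euclidean_space) riem_structure \<Rightarrow> real set \<Rightarrow> (real \<Rightarrow> 'a) \<Rightarrow> (real \<Rightarrow> 'e) \<Rightarrow> bool"
  where
  "parallel_along M S \<gamma> X \<longleftrightarrow> (\<forall>t\<in>S. has_covariant_derivative M S \<gamma> X 0 t)"

definition geodesic_on ::
    "('a::topological_space, 'e::euclidean_space) riem_structure \<Rightarrow> real set \<Rightarrow> (real \<Rightarrow> 'a) \<Rightarrow> bool"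
  where
  "geodesic_on M S \<gamma> \<longleftrightarrow> continuous_on S \<gamma> \<and>
     (\<forall>t\<in>S. (chart_map (chart_at M (\<gamma> t)) \<circ> \<gamma>) differentiable (at t within S)) \<and>
     parallel_along M S \<gamma> (velocity M S \<gamma>)"

definition geodesically_complete ::
    "('a::topological_space, 'e::euclidean_space) riem_structure \<Rightarrow> bool" where
  "geodesically_complete M \<longleftrightarrow>
     (\<forall>p v. \<exists>\<gamma>. geodesic_on M UNIV \<gamma> \<and> \<gamma> 0 = p \<and> velocity M UNIV \<gamma> 0 = v)"

text \<open>The geodesic with given initial data is unique, so the choice below is immaterial.\<close>

definition exp_map ::
    "('a::topological_space, 'e::euclidean_space) riem_structure \<Rightarrow> 'a \<Rightarrow> 'e \<Rightarrow> 'a" where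
  "exp_map M p v =
     (SOME \<gamma>. geodesic_on M UNIV \<gamma> \<and> \<gamma> 0 = p \<and> velocity M UNIV \<gamma> 0 = v) 1"

definition geodesic_segments ::
    "('a::topological_space, 'e::euclidean_space) riem_structure \<Rightarrow> 'a \<Rightarrow> 'a \<Rightarrow> (real \<Rightarrow> 'a) set"
  where
  "geodesic_segments M p q = {\<gamma>. geodesic_on M {0..1} \<gamma> \<and> \<gamma> 0 = p \<and> \<gamma> 1 = q}"

definition curve_length ::
    "('a, 'e::euclidean_space) riem_structure \<Rightarrow> (real \<Rightarrow> 'a) \<Rightarrow> real" where
  "curve_length M \<gamma> = integral {0..1} (\<lambda>t. rnorm M (\<gamma> t) (velocity M {0..1} \<gamma> t))"

definition parallel_transport ::
    "('a, 'e::euclidean_space) riem_structure \<Rightarrow> (real \<Rightarrow> 'a) \<Rightarrow> 'e \<Rightarrow> 'e" where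
  "parallel_transport M \<gamma> v = (THE w. \<exists>X. parallel_along M {0..1} \<gamma> X \<and> X 0 = v \<and> X 1 = w)"

definition continuously_differentiable ::
    "('a, 'e::euclidean_space) riem_structure \<Rightarrow> ('a \<Rightarrow> 'b::real_normed_vector) \<Rightarrow> bool" where
  "continuously_differentiable M f \<longleftrightarrow>
     (\<forall>c\<in>atlas M. ck_on 1 (chart_image c) (f \<circ> chart_inv c))"

definition differential_at ::
    "('a, 'e::euclidean_space) riem_structure \<Rightarrow> ('a \<Rightarrow> real) \<Rightarrow> 'a \<Rightarrow> 'e \<Rightarrow> real" where
  "differential_at M f p =
     (let c = chart_at M p in frechet_derivative (f \<circ> chart_inv c) (at (chart_map c p)))"

definition grad ::
    "('a, 'e::euclidean_space) riem_structure \<Rightarrow> ('a \<Rightarrow> real) \<Rightarrow> 'a \<Rightarrow> 'e" where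
  "grad M f p = (THE w. \<forall>v. rmetric M p w v = differential_at M f p v)"

definition component :: "('a \<Rightarrow> real ^ 'm) \<Rightarrow> 'm \<Rightarrow> 'a \<Rightarrow> real" where
  "component F i q = F q $ i"

definition componentwise_lipschitz_gradient ::
    "('a::topological_space, 'e::euclidean_space) riem_structure \<Rightarrow>
      ('a \<Rightarrow> real ^ 'm::finite) \<Rightarrow> real \<Rightarrow> bool" where
  "componentwise_lipschitz_gradient M F L \<longleftrightarrow>
     (\<exists>Lc :: 'm \<Rightarrow> real.
        (\<forall>i. 0 \<le> Lc i \<and>
           (\<forall>p q. \<forall>\<gamma> \<in> geodesic_segments M p q.
              rnorm M q (parallel_transport M \<gamma> (grad M (component F i) p)
                         - grad M (component F i) q)
              \<le> Lc i * curve_length M \<gamma>)) \<and>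
        L = (MAX i. Lc i))"

definition steepest_descent_direction ::
    "('a, 'e::euclidean_space) riem_structure \<Rightarrow> ('a \<Rightarrow> real ^ 'm::finite) \<Rightarrow> 'a \<Rightarrow> 'e" where
  "steepest_descent_direction M F p =
     arg_min (\<lambda>v. (MAX i. rmetric M p (grad M (component F i) p) v) + 1/2 * (rnorm M p v)\<^sup>2)
       (\<lambda>_. True)"

definition steepest_descent_sequence ::
    "('a::topological_space, 'e::euclidean_space) riem_structure \<Rightarrow> ('a \<Rightarrow> real ^ 'm::finite) \<Rightarrow>
      (nat \<Rightarrow> 'a) \<Rightarrow> (nat \<Rightarrow> 'e) \<Rightarrow> (nat \<Rightarrow> real) \<Rightarrow> bool" where
  "steepest_descent_sequence M F p v t \<longleftrightarrow>
     (\<forall>k. v k = steepest_descent_direction M F (p k) \<and> v k \<noteq> 0 \<and> 0 < t k \<and>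
        p (Suc k) = exp_map M (p k) (t k *\<^sub>R v k))"

definition sufficient_decrease ::
    "('a::topological_space, 'e::euclidean_space) riem_structure \<Rightarrow> ('a \<Rightarrow> real ^ 'm::finite) \<Rightarrow>
      real \<Rightarrow> 'a \<Rightarrow> 'e \<Rightarrow> real \<Rightarrow> bool" where
  "sufficient_decrease M F \<beta> p v s \<longleftrightarrow>
     F (exp_map M p (s *\<^sub>R v)) \<le> F p - (\<beta> * s * (rnorm M p v)\<^sup>2) *\<^sub>R 1"

definition lipschitz_stepsize :: "real \<Rightarrow> real \<Rightarrow> (nat \<Rightarrow> real) \<Rightarrow> bool" where
  "lipschitz_stepsize L \<epsilon> t \<longleftrightarrow> 0 < \<epsilon> \<and> (\<forall>k. \<epsilon> < t k \<and> t k \<le> 1 / L)"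

definition adaptive_stepsize ::
    "('a::topological_space, 'e::euclidean_space) riem_structure \<Rightarrow> ('a \<Rightarrow> real ^ 'm::finite) \<Rightarrow>
      real \<Rightarrow> real \<Rightarrow> real \<Rightarrow> real \<Rightarrow> (nat \<Rightarrow> 'a) \<Rightarrow> (nat \<Rightarrow> 'e) \<Rightarrow> (nat \<Rightarrow> real) \<Rightarrow> bool" where
  "adaptive_stepsize M F L \<zeta> L\<^sub>0 \<eta> p v t \<longleftrightarrow>
     0 < \<zeta> \<and> \<zeta> \<le> 1/2 \<and> 0 < L\<^sub>0 \<and> L\<^sub>0 \<le> L \<and> 0 < \<eta> \<and> \<eta> < 1 \<and>
     (\<forall>k. let t_prev = (case k of 0 \<Rightarrow> 1 / L\<^sub>0 | Suc j \<Rightarrow> t j)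
          in \<exists>i::nat. sufficient_decrease M F \<zeta> (p k) (v k) (\<eta> ^ i * t_prev) \<and>
               (\<forall>j<i. \<not> sufficient_decrease M F \<zeta> (p k) (v k) (\<eta> ^ j * t_prev)) \<and>
               t k = \<eta> ^ i * t_prev)"

definition armijo_stepsize ::
    "('a::topological_space, 'e::euclidean_space) riem_structure \<Rightarrow> ('a \<Rightarrow> real ^ 'm::finite) \<Rightarrow>
      real \<Rightarrow> real \<Rightarrow> real \<Rightarrow> real \<Rightarrow> real \<Rightarrow> real \<Rightarrow>
      (nat \<Rightarrow> 'a) \<Rightarrow> (nat \<Rightarrow> 'e) \<Rightarrow> (nat \<Rightarrow> real) \<Rightarrow> bool" where
  "armijo_stepsize M F L t_min t_max \<omega>\<^sub>1 \<omega>\<^sub>2 \<delta> p v t \<longleftrightarrow>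
     0 < t_min \<and> t_min < t_max \<and> 0 < \<omega>\<^sub>1 \<and> \<omega>\<^sub>1 < \<omega>\<^sub>2 \<and> \<omega>\<^sub>2 < 1 \<and> 0 < \<delta> \<and> \<delta> < 1 \<and>
     t_max > 2 * (1 - \<delta>) / L \<and> t_min < 2 * \<omega>\<^sub>1 * (1 - \<delta>) / L \<and>
     (\<forall>k. \<exists>(s :: nat \<Rightarrow> real) n.
        s 0 \<in> {t_min..t_max} \<and>
        (\<forall>l<n. \<not> sufficient_decrease M F \<delta> (p k) (v k) (s l) \<and>
               s (Suc l) \<in> {\<omega>\<^sub>1 * s l..\<omega>\<^sub>2 * s l}) \<and>
        sufficient_decrease M F \<delta> (p k) (v k) (s n) \<and>
        t k = s n)"

definition optimality_gap :: "('a \<Rightarrow> real ^ 'm) \<Rightarrow> 'm \<Rightarrow> 'a \<Rightarrow> ereal" where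
  "optimality_gap F i q = ereal (component F i q) - (INF x. ereal (component F i x))"

end

theory Submission
  imports Defs
begin

text \<open>
  The bound is a telescoping sum. If every step decreases every component of \<open>F\<close> by at least
  \<open>\<nu> t\<^sub>k \<parallel>v\<^sub>k\<parallel>\<^sup>2\<close> and \<open>t\<^sub>k \<ge> \<xi>\<close>, then \<open>N\<close> steps together decrease \<open>f\<^sub>i\<close> by at least \<open>N \<nu> \<xi>\<close> times
  the smallest \<open>\<parallel>v\<^sub>k\<parallel>\<^sup>2\<close>, and no component can decrease by more than its optimality gap. Since some
  component is bounded below, the minimal gap is finite (\<open>optimality_gap_finite\<close>).

  The decrease comes from the estimate
  \<open>f(exp\<^sub>p v) \<le> f(p) + \<langle>grad f(p), v\<rangle> + (K/2) \<parallel>v\<parallel>\<^sup>2\<close>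
  for functions with \<open>K\<close>-Lipschitz gradient (\<open>exp_map_descent\<close>), applied to \<open>s\<close> times the
  steepest descent direction \<open>v\<close>, for which \<open>\<langle>grad f\<^sub>i(p), v\<rangle> \<le> - \<parallel>v\<parallel>\<^sup>2\<close> holds for all \<open>i\<close>
  (\<open>steepest_descent_slope\<close>). Hence every step \<open>s \<le> 2 (1 - \<beta>) / L\<close> passes the test with parameter \<open>\<beta>\<close>
  (\<open>small_step_sufficient_decrease\<close>). For the two backtracking strategies this says that a
  rejected trial was longer than an explicit threshold, so the accepted step is not too short
  (\<open>stepsize_decrease\<close>).

  To see the estimate, let \<open>\<gamma>\<close> be a geodesic with initial velocity \<open>v\<close> and let \<open>\<phi> = f \<circ> \<gamma>\<close>, so that
  \<open>\<phi>' = \<langle>grad f, \<gamma>'\<rangle>\<close>. Parallel transport \<open>P\<close> along \<open>\<gamma>\<close> is isometric and carries \<open>\<gamma>'(a)\<close> to \<open>\<gamma>'(b)\<close>,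
  whence \<open>\<phi>'(b) - \<phi>'(a) = \<langle>grad f(\<gamma>(b)) - P grad f(\<gamma>(a)), \<gamma>'(b)\<rangle>\<close>, which by Cauchy-Schwarz is at most
  \<open>K \<parallel>v\<parallel>\<^sup>2 (b - a)\<close>. The hypothesis on gradients speaks about a transported vector only if the parallel
  field really exists and is unique. Uniqueness follows from isometry, existence from a linear
  differential equation. It is enough to have existence on segments that stay in one chart
  (\<open>parallel_field_exists\<close>): the bound on \<open>\<phi>'(b) - \<phi>'(a)\<close> is additive over adjacent intervals, so
  the local bounds on \<open>\<phi>'\<close> can be glued along \<open>\<gamma>\<close> (\<open>slope_difference\<close>), and no parallel fields need to
  be pieced together.

  What differential geometry is needed for this is derived from the Koszul formula in coordinates:
  compatibility with the metric, continuity of the Christoffel symbols, and their transformation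
  law. The transformation law is indispensable because the tangent vectors and covariant
  derivatives at different points of a curve refer to different preferred charts, while the
  differential equation has to be solved in one fixed chart.
\<close>

section \<open>Inner products on a Euclidean space\<close>

definition inner_form :: "('e::euclidean_space \<Rightarrow> 'e \<Rightarrow> real) \<Rightarrow> bool" where
  "inner_form B \<longleftrightarrow> bilinear B \<and> (\<forall>u v. B u v = B v u) \<and> (\<forall>v. v \<noteq> 0 \<longrightarrow> 0 < B v v)"

lemma inner_formD:
  assumes "inner_form B"
  shows "bilinear B" "B u v = B v u" "v \<noteq> 0 \<Longrightarrow> 0 < B v v" "0 \<le> B v v"
    and "linear (B u)" "linear (\<lambda>v. B v u)"
proof -
  show b: "bilinear B" and "B u v = B v u" and p: "v \<noteq> 0 \<Longrightarrow> 0 < B v v"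
    using assms unfolding inner_form_def by blast+
  show "0 \<le> B v v"
    by (cases "v = 0") (use p bilinear_lzero[OF b] in \<open>auto simp: less_imp_le\<close>)
  show "linear (B u)" "linear (\<lambda>v. B v u)"
    using b unfolding bilinear_def by blast+
qed

lemma inner_form_Cauchy_Schwarz:
  assumes "inner_form B"
  shows "B u v \<le> sqrt (B u u) * sqrt (B v v)"
proof (cases "v = 0")
  case True
  then show ?thesis using inner_formD(1)[OF assms] by (simp add: bilinear_rzero)
next
  case False
  note b = inner_formD(1)[OF assms]
  have pos: "0 < B v v" using inner_formD(3)[OF assms False] .
  define z where "z = B v v *\<^sub>R u - B u v *\<^sub>R v"
  have "B z z = B v v * (B v v * B u u - (B u v)\<^sup>2)"
    unfolding z_def using inner_formD(2)[OF assms, of v u]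
    by (simp add: bilinear_lsub[OF b] bilinear_rsub[OF b] bilinear_lmul[OF b] bilinear_rmul[OF b]
        algebra_simps power2_eq_square)
  then have "0 \<le> B v v * B u u - (B u v)\<^sup>2"
    using inner_formD(4)[OF assms, of z] pos by (simp add: zero_le_mult_iff)
  then have "(B u v)\<^sup>2 \<le> B u u * B v v" by (simp add: mult.commute)
  then have "sqrt ((B u v)\<^sup>2) \<le> sqrt (B u u * B v v)" by (rule real_sqrt_le_mono)
  then show ?thesis by (simp add: real_sqrt_mult)
qed

lemma inner_form_eqI:
  assumes "inner_form B" and "\<And>w. B z w = B z' w"
  shows "z = z'"
proof -
  have "B (z - z') (z - z') = 0"
    using assms(2)[of "z - z'"] by (simp add: bilinear_lsub[OF inner_formD(1)[OF assms(1)]])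
  then show ?thesis using inner_formD(3)[OF assms(1), of "z - z'"] by fastforce
qed

text \<open>The definite descriptions that define gradients and Christoffel symbols denote for this reason:
  sending \<open>z\<close> to the coefficients of \<open>B z\<close> is injective by definiteness, hence bijective.\<close>

lemma inner_form_Riesz:
  fixes B :: "'e::euclidean_space \<Rightarrow> 'e \<Rightarrow> real"
  assumes "inner_form B" and l: "linear l"
  shows "\<exists>!z. \<forall>w. B z w = l w"
proof -
  note b = inner_formD(1)[OF assms(1)]
  define T where "T z = (\<Sum>b\<in>Basis. B z b *\<^sub>R b)" for z
  have T: "T z \<bullet> b = B z b" if "b \<in> Basis" for z b
    using that by (simp add: T_def inner_sum_left inner_Basis if_distrib cong: if_cong)
  have lin: "linear T"
    by (rule linearI)
      (simp_all add: T_def bilinear_ladd[OF b] bilinear_lmul[OF b] scaleR_add_left sum.distrib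
        scaleR_sum_right)
  have eq_on_Basis: "B z w = l' w" if "linear l'" "\<And>b. b \<in> Basis \<Longrightarrow> B z b = l' b" for z w l'
    using linear_eq_stdbasis[OF inner_formD(5)[OF assms(1)] that] by metis
  have "inj T"
    unfolding linear_injective_0[OF lin]
  proof (intro allI impI)
    fix z assume "T z = 0"
    then have "B z b = 0" if "b \<in> Basis" for b using T[OF that, of z] by simp
    then have "B z w = 0" for w
      using eq_on_Basis[of "\<lambda>_. 0"] by (simp add: linear_zero)
    then show "z = 0" using inner_formD(3)[OF assms(1), of z] by fastforce
  qed
  then have "surj T" using linear_injective_imp_surjective[OF lin] by blast
  then obtain z where z: "T z = (\<Sum>b\<in>Basis. l b *\<^sub>R b)" by (metis surjD)
  have "B z b = l b" if "b \<in> Basis" for b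
    using T[OF that, of z] that unfolding z
    by (simp add: inner_sum_left inner_Basis if_distrib cong: if_cong)
  then have "\<forall>w. B z w = l w" using eq_on_Basis[OF l] by blast
  then show ?thesis using inner_form_eqI[OF assms(1)] by metis
qed

text \<open>Homogeneity reduces the bound to the unit sphere, where compactness gives a positive minimum.\<close>

lemma inner_form_coercive:
  fixes B :: "'e::euclidean_space \<Rightarrow> 'e \<Rightarrow> real"
  assumes "inner_form B"
  obtains c where "0 < c" "\<And>z. c * (norm z)\<^sup>2 \<le> B z z"
proof -
  note b = inner_formD(1)[OF assms]
  have cont: "continuous_on (sphere 0 1) (\<lambda>z. B z z)"
    by (rule bilinear_continuous_on_compose[OF continuous_on_id continuous_on_id b])
  obtain b0 :: 'e where "b0 \<in> Basis" using nonempty_Basis by blast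
  then have "sphere (0::'e) 1 \<noteq> {}" by (metis norm_Basis mem_sphere_0 empty_iff)
  then obtain z0 where z0: "z0 \<in> sphere 0 1" "\<And>z. z \<in> sphere 0 1 \<Longrightarrow> B z0 z0 \<le> B z z"
    using continuous_attains_inf[OF compact_sphere _ cont] by blast
  show ?thesis
  proof
    show "0 < B z0 z0" using z0(1) inner_formD(3)[OF assms, of z0] by fastforce
    fix z :: 'e
    show "B z0 z0 * (norm z)\<^sup>2 \<le> B z z"
    proof (cases "z = 0")
      case True then show ?thesis by (simp add: bilinear_lzero[OF b])
    next
      case False
      then have "B z0 z0 \<le> B (z /\<^sub>R norm z) (z /\<^sub>R norm z)" by (intro z0(2)) simp
      also have "\<dots> = B z z / (norm z)\<^sup>2"
        by (simp add: bilinear_lmul[OF b] bilinear_rmul[OF b] power2_eq_square divide_inverse)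
      finally show ?thesis using False by (simp add: field_simps)
    qed
  qed
qed

lemma inner_form_compose:
  assumes "inner_form B" "linear A" "\<And>v. A v = 0 \<Longrightarrow> v = 0"
  shows "inner_form (\<lambda>u v. B (A u) (A v))"
proof -
  have "0 < B (A v) (A v)" if "v \<noteq> 0" for v
    using inner_formD(3)[OF assms(1)] assms(3) that by blast
  then show ?thesis
    unfolding inner_form_def bilinear_def
    using linear_compose[OF assms(2) inner_formD(5)[OF assms(1)]]
      linear_compose[OF assms(2) inner_formD(6)[OF assms(1)]] inner_formD(2)[OF assms(1)]
    by (auto simp: o_def)
qed

lemma linear_representation:
  fixes A :: "'e::euclidean_space \<Rightarrow> 'b::real_normed_vector"
  assumes "linear A"
  shows "A v = (\<Sum>b\<in>Basis. (v \<bullet> b) *\<^sub>R A b)"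
proof -
  have "A v = A (\<Sum>b\<in>Basis. (v \<bullet> b) *\<^sub>R b)" by (simp add: euclidean_representation)
  also have "\<dots> = (\<Sum>b\<in>Basis. (v \<bullet> b) *\<^sub>R A b)"
    by (simp add: linear_sum[OF assms] linear_scale[OF assms])
  finally show ?thesis .
qed

text \<open>The Christoffel symbols are given only implicitly, by the Koszul equations \<open>G x (z x) w = k x w\<close>;
  this is how their continuity is obtained. Coercivity turns a small residual into a small error:
  a multiple of \<open>\<parallel>z x - z x\<^sub>0\<parallel>\<^sup>2\<close> is bounded by \<open>G x\<close> on that difference, which equals
  \<open>k x - G x (z x\<^sub>0)\<close> applied to \<open>z x - z x\<^sub>0\<close>, and the residual \<open>k x - G x (z x\<^sub>0)\<close> tends to \<open>0\<close>.\<close>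

lemma continuous_on_inner_form_solution:
  fixes G :: "'p::topological_space \<Rightarrow> 'e::euclidean_space \<Rightarrow> 'e \<Rightarrow> real"
  assumes G: "\<And>x. x \<in> S \<Longrightarrow> inner_form (G x)"
    and contG: "\<And>u v. continuous_on S (\<lambda>x. G x u v)"
    and contk: "\<And>w. continuous_on S (\<lambda>x. k x w)"
    and z: "\<And>x w. x \<in> S \<Longrightarrow> G x (z x) w = k x w"
  shows "continuous_on S z"
  unfolding continuous_on_def
proof
  fix x0 assume x0: "x0 \<in> S"
  let ?F = "at x0 within S"
  obtain c where c: "0 < c" "\<And>z. c * (norm z)\<^sup>2 \<le> G x0 z z"
    using inner_form_coercive[OF G[OF x0]] by blast
  define e where "e x = (\<Sum>i\<in>Basis. \<Sum>j\<in>Basis. \<bar>G x i j - G x0 i j\<bar>)" for x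
  define r where "r x = (\<Sum>i\<in>Basis. \<bar>k x i - G x (z x0) i\<bar>)" for x
  have "((\<lambda>x. \<Sum>i\<in>Basis. \<Sum>j\<in>Basis. \<bar>G x i j - G x0 i j\<bar>) \<longlongrightarrow>
      (\<Sum>i\<in>Basis. \<Sum>j\<in>Basis. \<bar>G x0 i j - G x0 i j\<bar>)) ?F"
    using contG x0 unfolding continuous_on_def by (intro tendsto_intros) auto
  then have e0: "(e \<longlongrightarrow> 0) ?F" unfolding e_def by simp
  have "((\<lambda>x. \<Sum>i\<in>Basis. \<bar>k x i - G x (z x0) i\<bar>) \<longlongrightarrow>
      (\<Sum>i\<in>Basis. \<bar>k x0 i - G x0 (z x0) i\<bar>)) ?F"
    using contG contk x0 unfolding continuous_on_def by (intro tendsto_intros) auto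
  then have r0: "(r \<longlongrightarrow> 0) ?F" unfolding r_def by (simp add: z[OF x0])
  have bound: "norm (z x - z x0) \<le> r x * (2 / c)" if x: "x \<in> S" and ex: "e x < c / 2" for x
  proof -
    define Z where "Z = z x - z x0"
    note lin = inner_formD(5,6)[OF G]
    have expand: "G y Z Z = (\<Sum>i\<in>Basis. \<Sum>j\<in>Basis. (Z \<bullet> i) * ((Z \<bullet> j) * G y i j))" if "y \<in> S" for y
    proof -
      have "G y Z Z = (\<Sum>i\<in>Basis. (Z \<bullet> i) *\<^sub>R G y i Z)"
        by (rule linear_representation[OF lin(2)[OF that]])
      also have "\<dots> = (\<Sum>i\<in>Basis. (Z \<bullet> i) *\<^sub>R (\<Sum>j\<in>Basis. (Z \<bullet> j) *\<^sub>R G y i j))"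
        by (intro sum.cong refl arg_cong[where f = "scaleR _"] linear_representation[OF lin(1)[OF that]])
      finally show ?thesis by (simp add: sum_distrib_left)
    qed
    have "G x0 Z Z - G x Z Z \<le> \<bar>G x Z Z - G x0 Z Z\<bar>" by linarith
    also have "\<dots> =
       \<bar>\<Sum>i\<in>Basis. \<Sum>j\<in>Basis. (Z \<bullet> i) * ((Z \<bullet> j) * (G x i j - G x0 i j))\<bar>"
      unfolding expand[OF x] expand[OF x0] by (simp add: sum_subtractf right_diff_distrib)
    also have "\<dots> \<le> (\<Sum>i\<in>Basis. \<Sum>j\<in>Basis. \<bar>(Z \<bullet> i) * ((Z \<bullet> j) * (G x i j - G x0 i j))\<bar>)"
      by (rule order_trans[OF sum_abs], rule sum_mono, rule sum_abs)
    also have "\<dots> \<le> (\<Sum>i\<in>Basis. \<Sum>j\<in>Basis. (norm Z)\<^sup>2 * \<bar>G x i j - G x0 i j\<bar>)"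
    proof (intro sum_mono)
      fix i j :: 'e assume "i \<in> Basis" "j \<in> Basis"
      then have "\<bar>Z \<bullet> i\<bar> * \<bar>Z \<bullet> j\<bar> \<le> norm Z * norm Z"
        by (intro mult_mono Basis_le_norm) auto
      then have "\<bar>Z \<bullet> i\<bar> * \<bar>Z \<bullet> j\<bar> * \<bar>G x i j - G x0 i j\<bar> \<le> (norm Z)\<^sup>2 * \<bar>G x i j - G x0 i j\<bar>"
        by (intro mult_right_mono) (auto simp: power2_eq_square)
      then show "\<bar>(Z \<bullet> i) * ((Z \<bullet> j) * (G x i j - G x0 i j))\<bar> \<le> (norm Z)\<^sup>2 * \<bar>G x i j - G x0 i j\<bar>"
        by (simp add: abs_mult mult.assoc)
    qed
    also have "\<dots> = (norm Z)\<^sup>2 * e x" unfolding e_def by (simp add: sum_distrib_left)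
    also have "\<dots> \<le> (norm Z)\<^sup>2 * (c / 2)" using ex by (intro mult_left_mono) auto
    finally have "G x0 Z Z - G x Z Z \<le> c * (norm Z)\<^sup>2 / 2" by (simp add: mult.commute)
    then have lower: "c / 2 * (norm Z)\<^sup>2 \<le> G x Z Z" using c(2)[of Z] by linarith
    have "G x Z Z = k x Z - G x (z x0) Z"
      unfolding Z_def by (simp add: linear_diff[OF lin(2)[OF x]] z[OF x])
    also have "\<dots> = (\<Sum>i\<in>Basis. (Z \<bullet> i) *\<^sub>R G x (z x) i) - (\<Sum>i\<in>Basis. (Z \<bullet> i) *\<^sub>R G x (z x0) i)"
      unfolding z[OF x, symmetric]
      by (intro arg_cong2[where f = minus] linear_representation[OF lin(1)[OF x]])
    also have "\<dots> = (\<Sum>i\<in>Basis. (Z \<bullet> i) * (k x i - G x (z x0) i))"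
      by (simp add: z[OF x] sum_subtractf right_diff_distrib)
    also have "\<dots> \<le> (\<Sum>i\<in>Basis. norm Z * \<bar>k x i - G x (z x0) i\<bar>)"
    proof (rule sum_mono)
      fix i :: 'e assume i: "i \<in> Basis"
      have "(Z \<bullet> i) * (k x i - G x (z x0) i) \<le> \<bar>Z \<bullet> i\<bar> * \<bar>k x i - G x (z x0) i\<bar>"
        by (metis abs_ge_self abs_mult)
      also have "\<dots> \<le> norm Z * \<bar>k x i - G x (z x0) i\<bar>"
        by (intro mult_right_mono Basis_le_norm i) auto
      finally show "(Z \<bullet> i) * (k x i - G x (z x0) i) \<le> norm Z * \<bar>k x i - G x (z x0) i\<bar>" .
    qed
    also have "\<dots> = norm Z * r x" unfolding r_def by (simp add: sum_distrib_left)
    finally have "norm Z * (c / 2 * norm Z) \<le> norm Z * r x"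
      using lower by (simp add: power2_eq_square algebra_simps)
    moreover have "0 \<le> r x" unfolding r_def by (simp add: sum_nonneg)
    ultimately have "c / 2 * norm Z \<le> r x"
      by (cases "norm Z = 0") (auto simp: mult_le_cancel_left)
    then show ?thesis unfolding Z_def using c(1) by (simp add: field_simps)
  qed
  have "((\<lambda>x. z x - z x0) \<longlongrightarrow> 0) ?F"
  proof (rule Lim_null_comparison)
    have "\<forall>\<^sub>F x in ?F. e x < c / 2" by (rule order_tendstoD(2)[OF e0]) (use c(1) in simp)
    moreover have "\<forall>\<^sub>F x in ?F. x \<in> S" by (simp add: eventually_at_filter)
    ultimately show "\<forall>\<^sub>F x in ?F. norm (z x - z x0) \<le> r x * (2 / c)"
      by eventually_elim (rule bound)
    show "((\<lambda>x. r x * (2 / c)) \<longlongrightarrow> 0) ?F" using tendsto_mult_right[OF r0, of "2 / c"] by simp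
  qed
  then show "(z \<longlongrightarrow> z x0) ?F" by (simp add: Lim_null[symmetric])
qed

section \<open>Derivatives of families of linear and bilinear maps\<close>

text \<open>A product rule under the weak hypothesis that \<open>A x v\<close> is differentiable in \<open>x\<close> for each fixed \<open>v\<close>:
  expanding the argument in a basis leaves finitely many ordinary products. The parameter \<open>s\<close> is
  time when fields along curves are differentiated, and a coordinate vector when the metric is
  pulled back along a transition map.\<close>

lemma has_derivative_linear_family:
  fixes A :: "'p::real_normed_vector \<Rightarrow> 'e::euclidean_space \<Rightarrow> 'b::real_normed_vector"
    and y :: "'c::real_normed_vector \<Rightarrow> 'p"
  assumes S: "open S" "y t \<in> S" "t \<in> T"
    and lin: "\<And>x. x \<in> S \<Longrightarrow> linear (A x)"
    and D: "\<And>v. ((\<lambda>x. A x v) has_derivative D v) (at (y t))"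
    and y: "(y has_derivative y') (at t within T)"
    and X: "(X has_derivative X') (at t within T)"
  shows "((\<lambda>s. A (y s) (X s)) has_derivative (\<lambda>h. A (y t) (X' h) + D (X t) (y' h))) (at t within T)"
proof -
  have ev: "\<forall>\<^sub>F s in at t within T. y s \<in> S"
    using has_derivative_continuous[OF y] S unfolding continuous_within
    by (simp add: topological_tendstoD)
  have D': "((\<lambda>x. A x v) has_derivative (\<lambda>h. \<Sum>b\<in>Basis. (v \<bullet> b) *\<^sub>R D b h)) (at (y t))" for v
  proof (rule has_derivative_transform_within_open[OF _ S(1,2)])
    show "((\<lambda>x. \<Sum>b\<in>Basis. (v \<bullet> b) *\<^sub>R A x b) has_derivative
        (\<lambda>h. \<Sum>b\<in>Basis. (v \<bullet> b) *\<^sub>R D b h)) (at (y t))"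
      by (rule has_derivative_sum, rule has_derivative_scaleR_right, rule D)
    show "(\<Sum>b\<in>Basis. (v \<bullet> b) *\<^sub>R A x b) = A x v" if "x \<in> S" for x
      by (rule linear_representation[OF lin[OF that], symmetric])
  qed
  have D_eq: "D v h = (\<Sum>b\<in>Basis. (v \<bullet> b) *\<^sub>R D b h)" for v h
    using has_derivative_unique[OF D D', of v] by metis
  have "((\<lambda>s. \<Sum>b\<in>Basis. (X s \<bullet> b) *\<^sub>R A (y s) b) has_derivative
      (\<lambda>h. \<Sum>b\<in>Basis. (X t \<bullet> b) *\<^sub>R D b (y' h) + (X' h \<bullet> b) *\<^sub>R A (y t) b)) (at t within T)"
    by (rule has_derivative_sum, rule has_derivative_scaleR, rule has_derivative_inner_left, rule X,
        rule has_derivative_compose[OF y D])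
  then have "((\<lambda>s. A (y s) (X s)) has_derivative
      (\<lambda>h. \<Sum>b\<in>Basis. (X t \<bullet> b) *\<^sub>R D b (y' h) + (X' h \<bullet> b) *\<^sub>R A (y t) b)) (at t within T)"
  proof (rule has_derivative_transform_eventually)
    show "\<forall>\<^sub>F s in at t within T. (\<Sum>b\<in>Basis. (X s \<bullet> b) *\<^sub>R A (y s) b) = A (y s) (X s)"
      using ev by eventually_elim (simp add: linear_representation[OF lin, symmetric])
  qed (use S in \<open>auto simp: linear_representation[OF lin, symmetric]\<close>)
  moreover have "(\<Sum>b\<in>Basis. (X t \<bullet> b) *\<^sub>R D b (y' h) + (X' h \<bullet> b) *\<^sub>R A (y t) b)
      = A (y t) (X' h) + D (X t) (y' h)" for h
    unfolding sum.distrib linear_representation[OF lin[OF S(2)], symmetric] D_eq[symmetric]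
    by simp
  ultimately show ?thesis by simp
qed

lemma has_derivative_bilinear_family:
  fixes B :: "'p::real_normed_vector \<Rightarrow> 'e::euclidean_space \<Rightarrow> 'e \<Rightarrow> real"
    and y :: "'c::real_normed_vector \<Rightarrow> 'p"
  assumes S: "open S" "y t \<in> S" "t \<in> T"
    and bil: "\<And>x. x \<in> S \<Longrightarrow> bilinear (B x)"
    and D: "\<And>u v. ((\<lambda>x. B x u v) has_derivative D u v) (at (y t))"
    and y: "(y has_derivative y') (at t within T)"
    and X: "(X has_derivative X') (at t within T)"
    and Y: "(Y has_derivative Y') (at t within T)"
  shows "((\<lambda>s. B (y s) (X s) (Y s)) has_derivative
      (\<lambda>h. B (y t) (X' h) (Y t) + B (y t) (X t) (Y' h) + D (X t) (Y t) (y' h))) (at t within T)"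
proof -
  have l: "linear (B x u)" "linear (\<lambda>u. B x u v)" if "x \<in> S" for x u v
    using bil[OF that] unfolding bilinear_def by auto
  \<comment> \<open>With the pair of base point and first argument as parameter, the family is linear in the second
    argument.\<close>
  have open_prod: "open (S \<times> (UNIV::'e set))" using S(1) by (simp add: open_Times)
  have part: "((\<lambda>z. B (fst z) (snd z) v) has_derivative
       (\<lambda>h. B (y t) (snd h) v + D (X t) v (fst h))) (at (y t, X t))" for v
  proof -
    have "((\<lambda>z. B (fst z) (snd z) v) has_derivative
       (\<lambda>h. B (fst (y t, X t)) (snd h) v + D (snd (y t, X t)) v (fst h))) (at (y t, X t))"
      by (rule has_derivative_linear_family[where A = "\<lambda>x u. B x u v" and D = "\<lambda>u. D u v" and S = S])
        (use l S D in \<open>auto intro: has_derivative_fst[OF has_derivative_ident]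
          has_derivative_snd[OF has_derivative_ident]\<close>)
    then show ?thesis by simp
  qed
  have "((\<lambda>s. B (fst (y s, X s)) (snd (y s, X s)) (Y s)) has_derivative
      (\<lambda>h. B (fst (y t, X t)) (snd (y t, X t)) (Y' h) +
         (B (y t) (snd (y' h, X' h)) (Y t) + D (X t) (Y t) (fst (y' h, X' h))))) (at t within T)"
    by (rule has_derivative_linear_family[where A = "\<lambda>z. B (fst z) (snd z)" and y = "\<lambda>s. (y s, X s)"
          and S = "S \<times> UNIV"
          and D = "\<lambda>v h. B (y t) (snd h) v + D (X t) v (fst h)" and y' = "\<lambda>h. (y' h, X' h)"])
      (use l S part open_prod y X Y in \<open>auto intro!: has_derivative_Pair\<close>)
  then show ?thesis by (simp add: algebra_simps)
qed

section \<open>Smooth maps and the symmetry of second derivatives\<close>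

lemma smooth_onD:
  assumes "smooth_on S f" "x \<in> S"
  shows smooth_on_has_derivative: "(f has_derivative frechet_derivative f (at x)) (at x)"
    and smooth_on_frechet_derivative: "smooth_on S (\<lambda>x. frechet_derivative f (at x) v)"
    and smooth_on_imp_linear: "linear (frechet_derivative f (at x))"
proof -
  have "ck_on (Suc k) S f" for k using assms(1) unfolding smooth_on_def by blast
  then have "f differentiable (at x)" and *: "ck_on k S (\<lambda>x. frechet_derivative f (at x) v)" for k
    using assms(2) by auto
  then show d: "(f has_derivative frechet_derivative f (at x)) (at x)"
    by (simp add: frechet_derivative_works)
  show "smooth_on S (\<lambda>x. frechet_derivative f (at x) v)" unfolding smooth_on_def using * by blast
  show "linear (frechet_derivative f (at x))" by (rule has_derivative_linear[OF d])
qed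

lemma smooth_on_imp_continuous_on: "smooth_on S f \<Longrightarrow> continuous_on S f"
  unfolding smooth_on_def by (metis ck_on.simps(1))

text \<open>The mean value theorem in direction \<open>u\<close>, applied to the difference of \<open>f\<close> in direction \<open>v\<close>, and
  then once more in direction \<open>v\<close>.\<close>

lemma second_difference_mean_value:
  fixes f :: "'a::real_normed_vector \<Rightarrow> real"
  assumes f': "\<And>y. y \<in> S \<Longrightarrow> (f has_derivative f' y) (at y)"
    and f'': "\<And>y. y \<in> S \<Longrightarrow> ((\<lambda>y. f' y u) has_derivative f'' y) (at y)"
    and h: "0 < h"
    and sub: "\<And>s r. 0 \<le> s \<Longrightarrow> s \<le> h \<Longrightarrow> 0 \<le> r \<Longrightarrow> r \<le> h \<Longrightarrow> x + s *\<^sub>R u + r *\<^sub>R v \<in> S"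
  obtains s r where "0 < s" "s < h" "0 < r" "r < h"
    "f (x + h *\<^sub>R u + h *\<^sub>R v) - f (x + h *\<^sub>R u) - f (x + h *\<^sub>R v) + f x =
       h\<^sup>2 * f'' (x + s *\<^sub>R u + r *\<^sub>R v) v"
proof -
  have d1: "((\<lambda>s. g (a + s *\<^sub>R w)) has_real_derivative g' w) (at s)"
    if g: "(g has_derivative g') (at (a + s *\<^sub>R w))" for g :: "'a \<Rightarrow> real" and g' a w s
  proof -
    have "((\<lambda>s. a + s *\<^sub>R w) has_derivative (\<lambda>d. d *\<^sub>R w)) (at s)"
      by (auto intro!: derivative_eq_intros)
    from has_derivative_compose[OF this g]
    have "((\<lambda>s. g (a + s *\<^sub>R w)) has_derivative (\<lambda>d. g' (d *\<^sub>R w))) (at s)" .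
    moreover have "(\<lambda>d. g' (d *\<^sub>R w)) = (*) (g' w)"
      using linear_scale[OF has_derivative_linear[OF g]] by (auto simp: mult.commute)
    ultimately show ?thesis unfolding has_field_derivative_def by simp
  qed
  let ?G = "\<lambda>s. f ((x + h *\<^sub>R v) + s *\<^sub>R u) - f (x + s *\<^sub>R u)"
  have "\<exists>s>0. s < h \<and> ?G h - ?G 0 = (h - 0) *
      (f' ((x + h *\<^sub>R v) + s *\<^sub>R u) u - f' (x + s *\<^sub>R u) u)"
  proof (rule MVT2[OF h])
    fix s assume s: "0 \<le> s" "s \<le> h"
    have "(x + h *\<^sub>R v) + s *\<^sub>R u \<in> S" "x + s *\<^sub>R u \<in> S"
      using sub[OF s, of h] sub[OF s, of 0] h by (simp_all add: algebra_simps)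
    then show "(?G has_real_derivative f' ((x + h *\<^sub>R v) + s *\<^sub>R u) u - f' (x + s *\<^sub>R u) u) (at s)"
      by (intro DERIV_diff d1 f')
  qed
  then obtain s where s: "0 < s" "s < h"
    and G: "?G h - ?G 0 = h * (f' ((x + h *\<^sub>R v) + s *\<^sub>R u) u - f' (x + s *\<^sub>R u) u)" by auto
  let ?H = "\<lambda>r. f' ((x + s *\<^sub>R u) + r *\<^sub>R v) u"
  have "\<exists>r>0. r < h \<and> ?H h - ?H 0 = (h - 0) * f'' ((x + s *\<^sub>R u) + r *\<^sub>R v) v"
  proof (rule MVT2[OF h])
    fix r assume "0 \<le> r" "r \<le> h"
    then show "(?H has_real_derivative f'' ((x + s *\<^sub>R u) + r *\<^sub>R v) v) (at r)"
      using s by (intro d1 f'' sub) auto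
  qed
  then obtain r where r: "0 < r" "r < h"
    and H: "?H h - ?H 0 = h * f'' ((x + s *\<^sub>R u) + r *\<^sub>R v) v" by auto
  show ?thesis
  proof (rule that[OF s r])
    have e: "(x + h *\<^sub>R v) + s *\<^sub>R u = (x + s *\<^sub>R u) + h *\<^sub>R v"
       "(x + h *\<^sub>R v) + h *\<^sub>R u = (x + h *\<^sub>R u) + h *\<^sub>R v" by (simp_all add: algebra_simps)
    show "f (x + h *\<^sub>R u + h *\<^sub>R v) - f (x + h *\<^sub>R u) - f (x + h *\<^sub>R v) + f x =
       h\<^sup>2 * f'' (x + s *\<^sub>R u + r *\<^sub>R v) v"
      using G H unfolding e by (simp add: power2_eq_square algebra_simps)
  qed
qed

lemma second_derivative_symmetric_real:
  fixes f :: "'a::real_normed_vector \<Rightarrow> real"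
  assumes f': "\<And>y. y \<in> S \<Longrightarrow> (f has_derivative f' y) (at y)"
    and f'': "\<And>y u. y \<in> S \<Longrightarrow> ((\<lambda>y. f' y u) has_derivative f'' u y) (at y)"
    and cont: "\<And>u v. continuous_on S (\<lambda>y. f'' u y v)"
    and S: "open S" "x \<in> S"
  shows "f'' u x v = f'' v x u"
proof -
  define \<Delta> where "\<Delta> h = f (x + h *\<^sub>R u + h *\<^sub>R v) - f (x + h *\<^sub>R u) - f (x + h *\<^sub>R v) + f x" for h
  \<comment> \<open>The second difference quotient is symmetric in the two directions and has both mixed
    derivatives as its limit.\<close>
  have lim: "((\<lambda>h. \<Delta> h / h\<^sup>2) \<longlongrightarrow> f'' u' x v') (at_right 0)"
    if swap: "(u', v') = (u, v) \<or> (u', v') = (v, u)" for u' v'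
  proof (rule tendstoI)
    fix e :: real assume "0 < e"
    have "isCont (\<lambda>y. f'' u' y v') x" using S cont by (simp add: continuous_on_eq_continuous_at)
    then have "((\<lambda>y. f'' u' y v') \<longlongrightarrow> f'' u' x v') (nhds x)"
      using tendsto_at_iff_tendsto_nhds[of "\<lambda>y. f'' u' y v'" x] by (simp add: isCont_def)
    then have "\<forall>\<^sub>F y in nhds x. dist (f'' u' y v') (f'' u' x v') < e \<and> y \<in> S"
      using S \<open>0 < e\<close> by (intro eventually_conj) (simp_all add: tendstoD eventually_nhds_in_open)
    then obtain d where d: "0 < d" "\<And>y. dist y x < d \<Longrightarrow> dist (f'' u' y v') (f'' u' x v') < e \<and> y \<in> S"
      unfolding eventually_nhds_metric by blast
    define d' where "d' = d / (norm u' + norm v' + 1)"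
    have pos: "norm u' + norm v' + 1 > 0"
      using norm_ge_zero[of u'] norm_ge_zero[of v'] by linarith
    have d': "0 < d'" using d(1) pos unfolding d'_def by simp
    have near: "dist (x + s *\<^sub>R u' + r *\<^sub>R v') x < d" if "0 \<le> s" "s < d'" "0 \<le> r" "r < d'" for s r
    proof -
      have "dist (x + s *\<^sub>R u' + r *\<^sub>R v') x = norm (s *\<^sub>R u' + r *\<^sub>R v')"
        by (simp add: dist_norm add.assoc)
      also have "\<dots> \<le> s * norm u' + r * norm v'"
        using norm_triangle_ineq[of "s *\<^sub>R u'" "r *\<^sub>R v'"] that by simp
      also have "\<dots> \<le> d' * norm u' + d' * norm v'"
        using that by (intro add_mono mult_right_mono) auto
      also have "\<dots> < d' * (norm u' + norm v' + 1)" using d' by (simp add: algebra_simps)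
      also have "\<dots> = d" unfolding d'_def using pos by simp
      finally show ?thesis .
    qed
    have "dist (\<Delta> h / h\<^sup>2) (f'' u' x v') < e" if h: "0 < h" "h < d'" for h
    proof -
      have sub: "x + s *\<^sub>R u' + r *\<^sub>R v' \<in> S" if "0 \<le> s" "s \<le> h" "0 \<le> r" "r \<le> h" for s r
        using near[of s r] d(2) that h by auto
      obtain s r where sr: "0 < s" "s < h" "0 < r" "r < h"
        "f (x + h *\<^sub>R u' + h *\<^sub>R v') - f (x + h *\<^sub>R u') - f (x + h *\<^sub>R v') + f x =
         h\<^sup>2 * f'' u' (x + s *\<^sub>R u' + r *\<^sub>R v') v'"
        using second_difference_mean_value[of S f f' u' "f'' u'", OF f' f'' h(1) sub] by blast
      have "\<Delta> h = h\<^sup>2 * f'' u' (x + s *\<^sub>R u' + r *\<^sub>R v') v'"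
        using swap sr(5) by (auto simp: \<Delta>_def algebra_simps)
      then have "\<Delta> h / h\<^sup>2 = f'' u' (x + s *\<^sub>R u' + r *\<^sub>R v') v'" using h by simp
      then show ?thesis using d(2)[OF near[of s r]] sr h by simp
    qed
    then show "\<forall>\<^sub>F h in at_right 0. dist (\<Delta> h / h\<^sup>2) (f'' u' x v') < e"
      unfolding eventually_at_right_field using d' by auto
  qed
  show ?thesis
    by (rule tendsto_unique[OF _ lim lim]) simp_all
qed

text \<open>Pairing with a fixed vector \<open>b\<close> reduces to real-valued functions.\<close>

lemma smooth_on_second_derivative_symmetric:
  fixes f :: "'a::euclidean_space \<Rightarrow> 'b::real_inner"
  assumes sm: "smooth_on S f" and S: "open S" "x \<in> S"
  shows "frechet_derivative (\<lambda>y. frechet_derivative f (at y) u) (at x) v =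
         frechet_derivative (\<lambda>y. frechet_derivative f (at y) v) (at x) u"
proof -
  let ?D2 = "\<lambda>u y v. frechet_derivative (\<lambda>y. frechet_derivative f (at y) u) (at y) v"
  have sm1: "smooth_on S (\<lambda>y. frechet_derivative f (at y) u)" for u
    by (rule smooth_on_frechet_derivative[OF sm S(2)])
  have sm2: "smooth_on S (\<lambda>y. ?D2 u y v)" for u v
    by (rule smooth_on_frechet_derivative[OF sm1 S(2)])
  have "?D2 u x v \<bullet> b = ?D2 v x u \<bullet> b" for b
    by (rule second_derivative_symmetric_real[where f = "\<lambda>y. f y \<bullet> b" and S = S and x = x
          and f' = "\<lambda>y u. frechet_derivative f (at y) u \<bullet> b" and f'' = "\<lambda>u y v. ?D2 u y v \<bullet> b"])
      (use S in \<open>auto intro!: has_derivative_inner_left smooth_on_has_derivative[OF sm]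
        smooth_on_has_derivative[OF sm1] continuous_intros smooth_on_imp_continuous_on[OF sm2]\<close>)
  from this[of "?D2 u x v - ?D2 v x u"] have "(?D2 u x v - ?D2 v x u) \<bullet> (?D2 u x v - ?D2 v x u) = 0"
    unfolding inner_diff_left by simp
  then show ?thesis by simp
qed

section \<open>Linear differential equations\<close>

text \<open>Picard iteration for \<open>Z t = exp (- 2 K t) X t\<close>, where \<open>K\<close> bounds the coefficients. The weight makes
  the integral operator a contraction on the whole interval at once.\<close>

lemma linear_ode_solution_exists:
  fixes A :: "real \<Rightarrow> 'e::euclidean_space \<Rightarrow> 'e"
  assumes lin: "\<And>t. t \<in> {0..1} \<Longrightarrow> linear (A t)"
    and cont: "\<And>v. continuous_on {0..1} (\<lambda>t. A t v)"
  obtains X where "X 0 = x0" "\<And>t. t \<in> {0..1} \<Longrightarrow> (X has_vector_derivative A t (X t)) (at t within {0..1})"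
proof -
  have "continuous_on {0..1} (\<lambda>t. \<Sum>b\<in>Basis. norm (A t b))" by (intro continuous_intros cont)
  then have "bounded ((\<lambda>t. \<Sum>b\<in>Basis. norm (A t b)) ` {0..1})"
    by (intro compact_imp_bounded compact_continuous_image) auto
  then obtain K where K: "0 < K" "\<And>t. t \<in> {0..1} \<Longrightarrow> norm (\<Sum>b\<in>Basis. norm (A t b)) \<le> K"
    unfolding bounded_pos by auto
  have A_bound: "norm (A t v) \<le> K * norm v" if t: "t \<in> {0..1}" for t v
  proof -
    have "norm (A t v) = norm (\<Sum>b\<in>Basis. (v \<bullet> b) *\<^sub>R A t b)"
      by (rule arg_cong[where f = norm], rule linear_representation[OF lin[OF t]])
    also have "\<dots> \<le> (\<Sum>b\<in>Basis. norm v * norm (A t b))"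
      by (rule order_trans[OF norm_sum]) (auto intro!: sum_mono mult_right_mono Basis_le_norm)
    also have "\<dots> \<le> norm v * K"
      using K(2)[OF t] by (simp add: sum_distrib_left[symmetric] mult_left_mono)
    finally show ?thesis by (simp add: mult.commute)
  qed
  have contA: "continuous_on {0..1} (\<lambda>t. A t (Z t))" if "continuous_on {0..1} Z" for Z
  proof -
    have "continuous_on {0..1} (\<lambda>t. \<Sum>b\<in>Basis. (Z t \<bullet> b) *\<^sub>R A t b)"
      by (intro continuous_intros cont that)
    then show ?thesis
      by (rule continuous_on_eq) (rule linear_representation[OF lin, symmetric])
  qed
  define \<kappa> where "\<kappa> = 2 * K"
  have \<kappa>: "0 < \<kappa>" using K(1) by (simp add: \<kappa>_def)
  define R where "R Z t = exp (\<kappa> * t) *\<^sub>R A t (Z t)" for Z :: "real \<Rightarrow> 'e" and t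
  define W where "W Z t = exp (- \<kappa> * t) *\<^sub>R (x0 + integral {0..t} (R Z))" for Z t
  have contR: "continuous_on {0..1} (R Z)" if "continuous_on {0..1} Z" for Z
    unfolding R_def by (intro continuous_intros contA that)
  have contW: "continuous_on {0..1} (W Z)" if "continuous_on {0..1} Z" for Z
    unfolding W_def
    by (intro continuous_intros indefinite_integral_continuous_1 integrable_continuous_interval
        contR that)
  define cl :: "real \<Rightarrow> real" where "cl t = max 0 (min 1 t)" for t
  have cl: "cl t \<in> {0..1}" "t \<in> {0..1} \<Longrightarrow> cl t = t" for t by (auto simp: cl_def)
  have Wb: "(\<lambda>t. W Z (cl t)) \<in> bcontfun" if "continuous_on {0..1} Z" for Z
  proof -
    have "bounded (W Z ` {0..1})"
      by (intro compact_imp_bounded compact_continuous_image contW that) simp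
    then obtain B where "\<forall>t\<in>{0..1}. norm (W Z t) \<le> B" unfolding bounded_iff by auto
    then show ?thesis
      using cl(1)
      by (intro bcontfun_normI[where b = B] continuous_on_compose2[OF contW[OF that]])
        (auto simp: cl_def intro!: continuous_intros)
  qed
  define T where "T Z = Bcontfun (\<lambda>t. W (apply_bcontfun Z) (cl t))" for Z :: "real \<Rightarrow>\<^sub>C 'e"
  have T: "apply_bcontfun (T Z) t = W (apply_bcontfun Z) (cl t)" for Z t
    unfolding T_def by (simp add: Bcontfun_inverse[OF Wb])
  have contr: "norm (W (apply_bcontfun Z) t - W (apply_bcontfun Z') t) \<le> 1/2 * dist Z Z'"
    if t: "t \<in> {0..1}" for Z Z' :: "real \<Rightarrow>\<^sub>C 'e" and t
  proof -
    let ?Z = "apply_bcontfun Z" and ?Z' = "apply_bcontfun Z'"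
    have int: "R (apply_bcontfun Y) integrable_on {0..t}" for Y
      by (intro integrable_continuous_interval continuous_on_subset[OF contR]) (use t in auto)
    have "((\<lambda>s. exp (\<kappa> * s)) has_integral (exp (\<kappa> * t) / \<kappa> - exp (\<kappa> * 0) / \<kappa>)) {0..t}"
      by (rule fundamental_theorem_of_calculus)
        (use t \<kappa> in \<open>auto intro!: derivative_eq_intros simp: has_real_derivative_iff_has_vector_derivative[symmetric]\<close>)
    then have expint: "((\<lambda>s. exp (\<kappa> * s) * (K * dist Z Z')) has_integral
        ((exp (\<kappa> * t) - 1) / \<kappa> * (K * dist Z Z'))) {0..t}"
      by (intro has_integral_mult_left) (simp add: diff_divide_distrib)
    have "norm (integral {0..t} (R ?Z) - integral {0..t} (R ?Z'))
        = norm (integral {0..t} (\<lambda>s. R ?Z s - R ?Z' s))"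
      by (simp add: integral_diff int)
    also have "\<dots> \<le> integral {0..t} (\<lambda>s. exp (\<kappa> * s) * (K * dist Z Z'))"
    proof (rule integral_norm_bound_integral)
      show "(\<lambda>s. R ?Z s - R ?Z' s) integrable_on {0..t}" by (intro integrable_diff int)
      show "(\<lambda>s. exp (\<kappa> * s) * (K * dist Z Z')) integrable_on {0..t}"
        using expint by (rule has_integral_integrable)
      fix s assume "s \<in> {0..t}"
      then have s: "s \<in> {0..1}" using t by auto
      have "norm (R ?Z s - R ?Z' s) = exp (\<kappa> * s) * norm (A s (?Z s - ?Z' s))"
        by (simp add: R_def linear_diff[OF lin[OF s]] scaleR_diff_right[symmetric])
      also have "\<dots> \<le> exp (\<kappa> * s) * (K * dist Z Z')"
        using order_trans[OF A_bound[OF s] mult_left_mono[OF dist_bounded[of Z s Z', unfolded dist_norm[of "?Z s"]]]] K(1)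
        by (simp add: less_imp_le)
      finally show "norm (R ?Z s - R ?Z' s) \<le> exp (\<kappa> * s) * (K * dist Z Z')" .
    qed
    also have "\<dots> = (exp (\<kappa> * t) - 1) / \<kappa> * (K * dist Z Z')"
      using expint by (rule integral_unique)
    also have "\<dots> \<le> exp (\<kappa> * t) / \<kappa> * (K * dist Z Z')"
      using K(1) \<kappa> by (intro mult_right_mono divide_right_mono) auto
    also have "\<dots> = exp (\<kappa> * t) * (1/2 * dist Z Z')" using K(1) by (simp add: \<kappa>_def)
    finally have *: "norm (integral {0..t} (R ?Z) - integral {0..t} (R ?Z')) \<le> exp (\<kappa> * t) * (1/2 * dist Z Z')" .
    have "W ?Z t - W ?Z' t = exp (- \<kappa> * t) *\<^sub>R (integral {0..t} (R ?Z) - integral {0..t} (R ?Z'))"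
      by (simp add: W_def algebra_simps)
    then have "norm (W ?Z t - W ?Z' t) = exp (- \<kappa> * t) * norm (integral {0..t} (R ?Z) - integral {0..t} (R ?Z'))"
      by simp
    also have "\<dots> \<le> exp (- \<kappa> * t) * (exp (\<kappa> * t) * (1/2 * dist Z Z'))"
      using * by (intro mult_left_mono) auto
    also have "\<dots> = 1/2 * dist Z Z'"
      unfolding mult.assoc[symmetric] by (simp add: exp_add[symmetric])
    finally show ?thesis .
  qed
  have "\<forall>Z Z'. dist (T Z) (T Z') \<le> 1/2 * dist Z Z'"
  proof (intro allI dist_bound)
    show "dist (apply_bcontfun (T Z) t) (apply_bcontfun (T Z') t) \<le> 1/2 * dist Z Z'" for Z Z' t
      unfolding T dist_norm[of "W _ _"] by (rule contr[OF cl(1)])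
  qed
  then obtain Z where Z: "T Z = Z" using banach_fix_type[of "1/2" T] by auto
  define X where "X t = x0 + integral {0..t} (R (apply_bcontfun Z))" for t
  have XZ: "X t = exp (\<kappa> * t) *\<^sub>R apply_bcontfun Z t" if t: "t \<in> {0..1}" for t
  proof -
    have "apply_bcontfun Z t = W (apply_bcontfun Z) t" using T[of Z t] t by (simp add: Z cl(2))
    then show ?thesis by (simp add: W_def X_def exp_add[symmetric])
  qed
  show ?thesis
  proof
    show "X 0 = x0" by (simp add: X_def)
    fix t :: real assume t: "t \<in> {0..1}"
    have "(X has_vector_derivative R (apply_bcontfun Z) t) (at t within {0..1})"
      unfolding X_def using integral_has_vector_derivative[OF contR t, of "apply_bcontfun Z"]
      by (auto intro!: derivative_eq_intros)
    moreover have "R (apply_bcontfun Z) t = A t (X t)"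
      by (simp add: R_def XZ[OF t] linear_scale[OF lin[OF t]])
    ultimately show "(X has_vector_derivative A t (X t)) (at t within {0..1})" by simp
  qed
qed

section \<open>Charts and the metric\<close>

locale riemannian =
  fixes M :: "('a::{t2_space, second_countable_topology}, 'e::euclidean_space) riem_structure"
  assumes riemannian_manifold: "riemannian_manifold M"
begin

lemma chart_at [simp]: "chart_at M p \<in> atlas M" "p \<in> chart_dom (chart_at M p)"
  using riemannian_manifold unfolding riemannian_manifold_def by auto

lemma chart_homeomorphism:
  assumes "c \<in> atlas M"
  shows "open (chart_dom c)" "open (chart_image c)"
    "homeomorphism (chart_dom c) (chart_image c) (chart_map c) (chart_inv c)"
  using riemannian_manifold assms unfolding riemannian_manifold_def is_chart_def by auto

lemma chart_inv_chart_map [simp]: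
  "c \<in> atlas M \<Longrightarrow> p \<in> chart_dom c \<Longrightarrow> chart_inv c (chart_map c p) = p"
  using chart_homeomorphism(3) homeomorphism_apply1 by blast

lemma chart_map_in_image [simp]: "p \<in> chart_dom c \<Longrightarrow> chart_map c p \<in> chart_image c"
  unfolding chart_image_def by blast

lemma chart_imageE:
  assumes "x \<in> chart_image c"
  obtains p where "p \<in> chart_dom c" "x = chart_map c p"
  using assms unfolding chart_image_def by blast

definition overlap :: "('a, 'e) chart \<Rightarrow> ('a, 'e) chart \<Rightarrow> 'e set" where
  "overlap c d = chart_map c ` (chart_dom c \<inter> chart_dom d)"

lemma open_overlap:
  assumes "c \<in> atlas M" "d \<in> atlas M"
  shows "open (overlap c d)"
proof -
  note c = chart_homeomorphism[OF assms(1)] and d = chart_homeomorphism(1)[OF assms(2)]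
  have "openin (top_of_set (chart_dom c)) (chart_dom c \<inter> chart_dom d)"
    using d by (simp add: openin_open_Int)
  then have "openin (top_of_set (chart_image c)) (overlap c d)"
    unfolding overlap_def by (rule homeomorphism_imp_open_map[OF c(3)])
  then show ?thesis using c(2) openin_open_trans by blast
qed

lemma chart_map_in_overlap [simp]:
  "p \<in> chart_dom c \<Longrightarrow> p \<in> chart_dom d \<Longrightarrow> chart_map c p \<in> overlap c d"
  unfolding overlap_def by blast

lemma transition_chart_map [simp]:
  "c \<in> atlas M \<Longrightarrow> p \<in> chart_dom c \<Longrightarrow> transition c d (chart_map c p) = chart_map d p"
  by (simp add: transition_def)

lemma smooth_transition:
  assumes "c \<in> atlas M" "d \<in> atlas M"
  shows "smooth_on (overlap c d) (transition c d)"
  using riemannian_manifold assms unfolding riemannian_manifold_def overlap_def by blast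

lemma has_derivative_transition:
  assumes "c \<in> atlas M" "d \<in> atlas M" "p \<in> chart_dom c" "p \<in> chart_dom d"
  shows "(transition c d has_derivative tangent_change c d p) (at (chart_map c p))"
  unfolding tangent_change_def
  using smooth_on_has_derivative[OF smooth_transition[OF assms(1,2)]] assms by simp

lemma linear_tangent_change:
  assumes "c \<in> atlas M" "d \<in> atlas M" "p \<in> chart_dom c" "p \<in> chart_dom d"
  shows "linear (tangent_change c d p)"
  by (rule has_derivative_linear[OF has_derivative_transition[OF assms]])

text \<open>The chain rule for \<open>transition d e \<circ> transition c d\<close>, which agrees with \<open>transition c e\<close> only near
  the point.\<close>

lemma tangent_change_trans:
  assumes "c \<in> atlas M" "d \<in> atlas M" "e \<in> atlas M"
    and p: "p \<in> chart_dom c" "p \<in> chart_dom d" "p \<in> chart_dom e"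
  shows "tangent_change d e p (tangent_change c d p v) = tangent_change c e p v"
proof -
  have "((\<lambda>x. transition d e (transition c d x)) has_derivative
      (\<lambda>v. tangent_change d e p (tangent_change c d p v))) (at (chart_map c p))"
    by (rule has_derivative_compose[OF has_derivative_transition])
      (use assms has_derivative_transition[of d e p] in auto)
  then have "(transition c e has_derivative
      (\<lambda>v. tangent_change d e p (tangent_change c d p v))) (at (chart_map c p))"
  proof (rule has_derivative_transform_within_open)
    show "open (overlap c d \<inter> overlap c e)" using open_overlap assms by blast
    show "chart_map c p \<in> overlap c d \<inter> overlap c e" using p by simp
    fix x assume "x \<in> overlap c d \<inter> overlap c e"
    then obtain q where "q \<in> chart_dom c" "q \<in> chart_dom d" "x = chart_map c q"
      unfolding overlap_def by blast
    then show "transition d e (transition c d x) = transition c e x" using assms by simp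
  qed
  from has_derivative_unique[OF this has_derivative_transition] assms show ?thesis by metis
qed

lemma tangent_change_self:
  assumes "c \<in> atlas M" "p \<in> chart_dom c"
  shows "tangent_change c c p v = v"
proof -
  have "(transition c c has_derivative (\<lambda>v. v)) (at (chart_map c p))"
  proof (rule has_derivative_transform_within_open[OF has_derivative_ident])
    show "open (chart_image c)" by (rule chart_homeomorphism(2)[OF assms(1)])
    show "x = transition c c x" if "x \<in> chart_image c" for x
      using that assms by (elim chart_imageE) simp
  qed (use assms in simp)
  from has_derivative_unique[OF this has_derivative_transition] assms show ?thesis by metis
qed

lemma tangent_change_inverse:
  assumes "c \<in> atlas M" "d \<in> atlas M" "p \<in> chart_dom c" "p \<in> chart_dom d"
  shows "tangent_change d c p (tangent_change c d p v) = v"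
  using tangent_change_trans[of c d c p v] tangent_change_self[of c p v] assms by simp

lemma inner_form_rmetric: "inner_form (rmetric M p)"
  using riemannian_manifold unfolding riemannian_manifold_def inner_form_def by blast

lemma metric_in_chart_commute: "metric_in_chart M c x u v = metric_in_chart M c x v u"
  unfolding metric_in_chart_def Let_def using inner_formD(2)[OF inner_form_rmetric] by blast

lemma inner_form_metric_in_chart:
  assumes "c \<in> atlas M" "x \<in> chart_image c"
  shows "inner_form (metric_in_chart M c x)"
proof -
  obtain p where p: "p \<in> chart_dom c" "x = chart_map c p" using assms(2) by (rule chart_imageE)
  have "inner_form (\<lambda>u v. rmetric M p (tangent_change c (chart_at M p) p u)
      (tangent_change c (chart_at M p) p v))"
  proof (rule inner_form_compose[OF inner_form_rmetric linear_tangent_change])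
    fix v assume "tangent_change c (chart_at M p) p v = 0"
    moreover have "tangent_change (chart_at M p) c p 0 = 0"
      by (rule linear_0[OF linear_tangent_change]) (use assms p in auto)
    ultimately show "v = 0" using tangent_change_inverse[of c "chart_at M p" p v] assms p by simp
  qed (use assms p in auto)
  moreover have "metric_in_chart M c x = (\<lambda>u v. rmetric M p (tangent_change c (chart_at M p) p u)
      (tangent_change c (chart_at M p) p v))"
    using assms p by (simp add: metric_in_chart_def fun_eq_iff)
  ultimately show ?thesis by simp
qed

lemma metric_tangent_change:
  assumes "c \<in> atlas M" "d \<in> atlas M" "p \<in> chart_dom c" "p \<in> chart_dom d"
  shows "metric_in_chart M d (chart_map d p) (tangent_change c d p u) (tangent_change c d p v)
       = metric_in_chart M c (chart_map c p) u v"
  using assms by (simp add: metric_in_chart_def tangent_change_trans)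

lemma rmetric_in_chart:
  assumes "c \<in> atlas M" "p \<in> chart_dom c"
  shows "rmetric M p u v = metric_in_chart M c (chart_map c p)
     (tangent_change (chart_at M p) c p u) (tangent_change (chart_at M p) c p v)"
  using assms by (simp add: metric_in_chart_def tangent_change_inverse)

lemma smooth_metric:
  "c \<in> atlas M \<Longrightarrow> smooth_on (chart_image c) (\<lambda>x. metric_in_chart M c x u v)"
  using riemannian_manifold unfolding riemannian_manifold_def by blast

section \<open>The Levi-Civita connection in charts\<close>

definition dmetric :: "('a, 'e) chart \<Rightarrow> 'e \<Rightarrow> 'e \<Rightarrow> 'e \<Rightarrow> 'e \<Rightarrow> real" where
  "dmetric c x u v = frechet_derivative (\<lambda>y. metric_in_chart M c y u v) (at x)"

lemma has_derivative_metric: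
  assumes "c \<in> atlas M" "x \<in> chart_image c"
  shows "((\<lambda>y. metric_in_chart M c y u v) has_derivative dmetric c x u v) (at x)"
  unfolding dmetric_def by (rule smooth_on_has_derivative[OF smooth_metric]) (use assms in auto)

lemma dmetric_commute: "dmetric c x u v w = dmetric c x v u w"
  unfolding dmetric_def by (simp add: metric_in_chart_commute[of c _ u v])

lemma linear_dmetric:
  assumes "c \<in> atlas M" "x \<in> chart_image c"
  shows "linear (dmetric c x u v)" "linear (\<lambda>v. dmetric c x u v w)" "linear (\<lambda>u. dmetric c x u v w)"
proof -
  show "linear (dmetric c x u v)" by (rule has_derivative_linear[OF has_derivative_metric[OF assms]])
  note eqI = has_derivative_unique[OF has_derivative_transform_within_open[OF _
        chart_homeomorphism(2)[OF assms(1)] assms(2)] has_derivative_metric[OF assms]]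
  note lin = inner_formD(5)[OF inner_form_metric_in_chart[OF assms(1)]]
  have add: "(\<lambda>w. dmetric c x u v w + dmetric c x u v' w) = dmetric c x u (v + v')" for u v v'
    by (rule eqI[OF has_derivative_add[OF has_derivative_metric[OF assms] has_derivative_metric[OF assms]]])
      (simp add: linear_add[OF lin])
  have scale: "(\<lambda>w. r * dmetric c x u v w) = dmetric c x u (r *\<^sub>R v)" for u v r
    by (rule eqI[OF has_derivative_mult_right[OF has_derivative_metric[OF assms]]])
      (simp add: linear_scale[OF lin])
  show 1: "linear (\<lambda>v. dmetric c x u v w)" for u
    by (rule linearI) (simp_all add: add[symmetric] scale[symmetric])
  show "linear (\<lambda>u. dmetric c x u v w)" using 1[of v] by (simp add: dmetric_commute[of c x _ v])
qed

lemma metric_christoffel: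
  assumes "c \<in> atlas M" "x \<in> chart_image c"
  shows "metric_in_chart M c x (christoffel M c x u v) w =
    (dmetric c x v w u + dmetric c x u w v - dmetric c x u v w) / 2"
proof -
  note l = linear_dmetric[OF assms]
  have lin: "linear (\<lambda>w. (dmetric c x v w u + dmetric c x u w v - dmetric c x u v w) / 2)"
    by (rule linearI)
      (simp_all add: linear_add[OF l(1)] linear_add[OF l(2)] linear_scale[OF l(1)]
        linear_scale[OF l(2)] field_simps)
  show ?thesis
    using theI'[OF inner_form_Riesz[OF inner_form_metric_in_chart[OF assms] lin]]
    unfolding christoffel_def dmetric_def by blast
qed

lemma linear_christoffel:
  assumes "c \<in> atlas M" "x \<in> chart_image c"
  shows "linear (christoffel M c x u)" "linear (\<lambda>u. christoffel M c x u v)"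
proof -
  note l = linear_dmetric[OF assms] and g = inner_form_metric_in_chart[OF assms]
    and m = metric_christoffel[OF assms]
  note add = linear_add[OF l(1)] linear_add[OF l(2)] linear_add[OF l(3)]
    linear_add[OF inner_formD(6)[OF g]]
    and scale = linear_scale[OF l(1)] linear_scale[OF l(2)] linear_scale[OF l(3)]
    linear_scale[OF inner_formD(6)[OF g]]
  show "linear (christoffel M c x u)" "linear (\<lambda>u. christoffel M c x u v)"
    by (auto intro!: linearI inner_form_eqI[OF g] simp: m add scale field_simps)
qed

text \<open>When the two Koszul formulas are added, four of the six derivatives of the metric cancel and the
  other two agree.\<close>

lemma metric_compatibility:
  assumes "c \<in> atlas M" "x \<in> chart_image c"
  shows "metric_in_chart M c x (christoffel M c x u v) w + metric_in_chart M c x v (christoffel M c x u w)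
    = dmetric c x v w u"
  unfolding metric_in_chart_commute[of c x v] metric_christoffel[OF assms]
  by (simp add: dmetric_commute[of c x w] field_simps dmetric_commute[of c x v u])

lemma continuous_christoffel:
  assumes "c \<in> atlas M"
  shows "continuous_on (chart_image c) (\<lambda>x. christoffel M c x u v)"
proof (rule continuous_on_inner_form_solution[OF inner_form_metric_in_chart[OF assms] _ _
      metric_christoffel[OF assms]])
  have d: "continuous_on (chart_image c) (\<lambda>x. dmetric c x u v w)" for u v w
  proof (cases "chart_image c = {}")
    case False
    then obtain x where "x \<in> chart_image c" by blast
    from smooth_on_frechet_derivative[OF smooth_metric[OF assms] this]
    show ?thesis unfolding dmetric_def by (rule smooth_on_imp_continuous_on)
  qed simp
  show "continuous_on (chart_image c)
      (\<lambda>x. (dmetric c x v w u + dmetric c x u w v - dmetric c x u v w) / 2)" for w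
    by (intro continuous_intros d) simp
  show "continuous_on (chart_image c) (\<lambda>x. metric_in_chart M c x u v)" for u v
    by (rule smooth_on_imp_continuous_on[OF smooth_metric[OF assms]])
qed

text \<open>Differentiating the identity \<open>g\<^sub>c(u, v) = g\<^sub>d(A u, A v)\<close>, where \<open>A\<close> is the derivative of the transition
  map, produces two terms with second derivatives of the transition map for each of the three
  derivatives in the Koszul formula. As second derivatives are symmetric, four of these six terms
  cancel and the other two agree.\<close>

lemma christoffel_transformation:
  assumes cd: "c \<in> atlas M" "d \<in> atlas M" and p: "p \<in> chart_dom c" "p \<in> chart_dom d"
  shows "tangent_change c d p (christoffel M c (chart_map c p) u v) =
      frechet_derivative (\<lambda>y. frechet_derivative (transition c d) (at y) v) (at (chart_map c p)) u
      + christoffel M d (chart_map d p) (tangent_change c d p u) (tangent_change c d p v)"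
proof -
  define x where "x = chart_map c p"
  define A where "A y = frechet_derivative (transition c d) (at y)" for y
  define D2 where "D2 v u = frechet_derivative (\<lambda>y. A y v) (at x) u" for u v
  have x: "x \<in> overlap c d" "x \<in> chart_image c" "transition c d x = chart_map d p"
    using cd p by (simp_all add: x_def)
  have Ax: "tangent_change c d p = A x" by (simp add: A_def x_def tangent_change_def)
  have xd: "chart_map d p \<in> chart_image d" using p by simp
  note gd = inner_form_metric_in_chart[OF cd(2) xd]
  have D2: "((\<lambda>y. A y v) has_derivative D2 v) (at x)" for v
    unfolding A_def D2_def
    by (rule smooth_on_has_derivative[OF smooth_on_frechet_derivative[OF smooth_transition[OF cd] x(1)] x(1)])
  have sym: "D2 u v = D2 v u" for u v
    unfolding D2_def A_def
    by (rule smooth_on_second_derivative_symmetric[OF smooth_transition[OF cd] open_overlap[OF cd] x(1)])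
  have key: "dmetric c x u v w = metric_in_chart M d (chart_map d p) (D2 u w) (A x v)
      + metric_in_chart M d (chart_map d p) (A x u) (D2 v w)
      + dmetric d (chart_map d p) (A x u) (A x v) (A x w)" for u v w
  proof -
    have "((\<lambda>y. metric_in_chart M d (transition c d y) (A y u) (A y v)) has_derivative
      (\<lambda>h. metric_in_chart M d (transition c d x) (D2 u h) (A x v)
         + metric_in_chart M d (transition c d x) (A x u) (D2 v h)
         + dmetric d (transition c d x) (A x u) (A x v) (A x h))) (at x)"
    proof (rule has_derivative_bilinear_family[OF chart_homeomorphism(2)[OF cd(2)]])
      show "(transition c d has_derivative A x) (at x)"
        unfolding A_def by (rule smooth_on_has_derivative[OF smooth_transition[OF cd] x(1)])
      show "bilinear (metric_in_chart M d y)" if "y \<in> chart_image d" for y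
        using inner_formD(1)[OF inner_form_metric_in_chart[OF cd(2) that]] .
      show "((\<lambda>y. metric_in_chart M d y u v) has_derivative dmetric d (transition c d x) u v)
          (at (transition c d x))" for u v
        using has_derivative_metric[OF cd(2) xd] x(3) by simp
    qed (use xd x D2 in auto)
    then have "((\<lambda>y. metric_in_chart M c y u v) has_derivative
      (\<lambda>h. metric_in_chart M d (transition c d x) (D2 u h) (A x v)
         + metric_in_chart M d (transition c d x) (A x u) (D2 v h)
         + dmetric d (transition c d x) (A x u) (A x v) (A x h))) (at x)"
    proof (rule has_derivative_transform_within_open[OF _ open_overlap[OF cd] x(1)])
      fix y assume "y \<in> overlap c d"
      then obtain q where q: "q \<in> chart_dom c" "q \<in> chart_dom d" "y = chart_map c q"
        unfolding overlap_def by blast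
      then show "metric_in_chart M d (transition c d y) (A y u) (A y v) = metric_in_chart M c y u v"
        using metric_tangent_change[OF cd q(1,2), of u v] cd by (simp add: A_def tangent_change_def)
    qed
    from has_derivative_unique[OF has_derivative_metric[OF cd(1) x(2)] this] show ?thesis
      unfolding x(3) by metis
  qed
  have "A x (christoffel M c x u v) = D2 v u + christoffel M d (chart_map d p) (A x u) (A x v)"
  proof (rule inner_form_eqI[OF gd])
    fix w'
    define w where "w = tangent_change d c p w'"
    have w: "w' = A x w"
      unfolding w_def Ax[symmetric] using tangent_change_inverse[OF cd(2,1) p(2,1)] by simp
    have "metric_in_chart M d (chart_map d p) (A x (christoffel M c x u v)) w'
        = metric_in_chart M c x (christoffel M c x u v) w"
      unfolding w x_def Ax[unfolded x_def, symmetric] by (rule metric_tangent_change[OF cd p])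
    also have "\<dots> = metric_in_chart M d (chart_map d p) (D2 v u) w'
        + metric_in_chart M d (chart_map d p) (christoffel M d (chart_map d p) (A x u) (A x v)) w'"
      unfolding metric_christoffel[OF cd(1) x(2)] metric_christoffel[OF cd(2) xd] key
      by (simp add: w sym[of u v] sym[of w] metric_in_chart_commute[of d _ "A x _" "D2 _ _"]
          field_simps)
    finally show "metric_in_chart M d (chart_map d p) (A x (christoffel M c x u v)) w' =
        metric_in_chart M d (chart_map d p)
          (D2 v u + christoffel M d (chart_map d p) (A x u) (A x v)) w'"
      by (simp add: linear_add[OF inner_formD(6)[OF gd]])
  qed
  then show ?thesis unfolding Ax D2_def A_def x_def .
qed

section \<open>Vector fields along curves\<close>

text \<open>The first conjunct excludes isolated parameters, at which the derivative that defines the velocity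
  would be an arbitrary vector.\<close>

definition regular_curve :: "real set \<Rightarrow> (real \<Rightarrow> 'a) \<Rightarrow> bool" where
  "regular_curve S \<gamma> \<longleftrightarrow> (\<forall>t\<in>S. at t within S \<noteq> bot) \<and> continuous_on S \<gamma> \<and>
     (\<forall>t\<in>S. (chart_map (chart_at M (\<gamma> t)) \<circ> \<gamma>) differentiable (at t within S))"

definition field_in_chart :: "('a, 'e) chart \<Rightarrow> (real \<Rightarrow> 'a) \<Rightarrow> (real \<Rightarrow> 'e) \<Rightarrow> real \<Rightarrow> 'e" where
  "field_in_chart c \<gamma> X s = tangent_change (chart_at M (\<gamma> s)) c (\<gamma> s) (X s)"

lemma regular_curve_eventually:
  assumes "regular_curve S \<gamma>" "t \<in> S" "open U" "\<gamma> t \<in> U"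
  shows "\<forall>\<^sub>F s in at t within S. \<gamma> s \<in> U"
  using assms unfolding regular_curve_def continuous_on_def by (blast dest: topological_tendstoD)

lemma field_in_chart_change:
  assumes "c \<in> atlas M" "d \<in> atlas M" "\<gamma> s \<in> chart_dom c" "\<gamma> s \<in> chart_dom d"
  shows "tangent_change c d (\<gamma> s) (field_in_chart c \<gamma> X s) = field_in_chart d \<gamma> X s"
  unfolding field_in_chart_def using assms by (simp add: tangent_change_trans)

lemma field_in_chart_at [simp]: "field_in_chart (chart_at M (\<gamma> t)) \<gamma> X t = X t"
  unfolding field_in_chart_def by (simp add: tangent_change_self)

lemma velocity_in_chart:
  assumes reg: "regular_curve S \<gamma>" and t: "t \<in> S" and c: "c \<in> atlas M" "\<gamma> t \<in> chart_dom c"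
  shows "((chart_map c \<circ> \<gamma>) has_vector_derivative field_in_chart c \<gamma> (velocity M S \<gamma>) t) (at t within S)"
proof -
  define d where "d = chart_at M (\<gamma> t)"
  have d: "d \<in> atlas M" "\<gamma> t \<in> chart_dom d" by (simp_all add: d_def)
  have "((chart_map d \<circ> \<gamma>) has_vector_derivative velocity M S \<gamma> t) (at t within S)"
    using reg t unfolding regular_curve_def velocity_def d_def
    by (simp add: vector_derivative_works[symmetric])
  then have "((chart_map d \<circ> \<gamma>) has_derivative (\<lambda>h. h *\<^sub>R velocity M S \<gamma> t)) (at t within S)"
    unfolding has_vector_derivative_def .
  from has_derivative_compose[OF this, of "transition d c"]
  have "((\<lambda>s. transition d c (chart_map d (\<gamma> s))) has_derivative
      (\<lambda>h. tangent_change d c (\<gamma> t) (h *\<^sub>R velocity M S \<gamma> t))) (at t within S)"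
    using has_derivative_transition[OF d(1) c(1) d(2) c(2)] by simp
  then have "((chart_map c \<circ> \<gamma>) has_derivative
      (\<lambda>h. tangent_change d c (\<gamma> t) (h *\<^sub>R velocity M S \<gamma> t))) (at t within S)"
  proof (rule has_derivative_transform_eventually)
    show "\<forall>\<^sub>F s in at t within S. transition d c (chart_map d (\<gamma> s)) = (chart_map c \<circ> \<gamma>) s"
      using regular_curve_eventually[OF reg t chart_homeomorphism(1)[OF d(1)] d(2)]
      by eventually_elim (use d in simp)
  qed (use d t in simp_all)
  then show ?thesis
    unfolding has_vector_derivative_def field_in_chart_def d_def[symmetric]
    by (simp add: linear_scale[OF linear_tangent_change[OF d(1) c(1) d(2) c(2)]])
qed

text \<open>Converting a field from one chart to another brings in the second derivative of the transition
  map; it is exactly the inhomogeneous term in the transformation law of the Christoffel symbols.\<close>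

lemma covariant_derivative_change_chart:
  assumes reg: "regular_curve S \<gamma>" and t: "t \<in> S"
    and c: "c \<in> atlas M" "\<gamma> t \<in> chart_dom c" and d: "d \<in> atlas M" "\<gamma> t \<in> chart_dom d"
    and X: "(field_in_chart c \<gamma> X has_vector_derivative
      field_in_chart c \<gamma> Y t - christoffel M c (chart_map c (\<gamma> t))
        (field_in_chart c \<gamma> (velocity M S \<gamma>) t) (field_in_chart c \<gamma> X t)) (at t within S)"
  shows "(field_in_chart d \<gamma> X has_vector_derivative
      field_in_chart d \<gamma> Y t - christoffel M d (chart_map d (\<gamma> t))
        (field_in_chart d \<gamma> (velocity M S \<gamma>) t) (field_in_chart d \<gamma> X t)) (at t within S)"
proof -
  define x where "x = chart_map c (\<gamma> t)"
  define Z where "Z = field_in_chart c \<gamma> X"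
  define V where "V = field_in_chart c \<gamma> (velocity M S \<gamma>) t"
  define Z' where "Z' = field_in_chart c \<gamma> Y t - christoffel M c x V (Z t)"
  define A where "A y = frechet_derivative (transition c d) (at y)" for y
  define D2 where "D2 v = frechet_derivative (\<lambda>y. A y v) (at x)" for v
  have x: "x \<in> overlap c d" using c d by (simp add: x_def)
  have AT: "A (chart_map c (\<gamma> s)) = tangent_change c d (\<gamma> s)" for s
    by (simp add: A_def tangent_change_def)
  note ch = field_in_chart_change[where \<gamma> = \<gamma> and s = t, OF c(1) d(1) c(2) d(2)]
  note lin = linear_tangent_change[OF c(1) d(1) c(2) d(2)]
  have D2: "((\<lambda>y. A y v) has_derivative D2 v) (at x)" for v
    unfolding A_def D2_def
    by (rule smooth_on_has_derivative[OF smooth_on_frechet_derivative[OF smooth_transition[OF c(1) d(1)] x] x])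
  have "((\<lambda>s. A ((chart_map c \<circ> \<gamma>) s) (Z s)) has_derivative
      (\<lambda>h. A ((chart_map c \<circ> \<gamma>) t) (h *\<^sub>R Z') + D2 (Z t) (h *\<^sub>R V))) (at t within S)"
  proof (rule has_derivative_linear_family[where A = A and y = "chart_map c \<circ> \<gamma>" and X = Z
        and D = D2 and y' = "\<lambda>h. h *\<^sub>R V" and X' = "\<lambda>h. h *\<^sub>R Z'",
        OF open_overlap[OF c(1) d(1)]])
    show "linear (A y)" if "y \<in> overlap c d" for y
      unfolding A_def by (rule smooth_on_imp_linear[OF smooth_transition[OF c(1) d(1)] that])
    show "((chart_map c \<circ> \<gamma>) has_derivative (\<lambda>h. h *\<^sub>R V)) (at t within S)"
      using velocity_in_chart[OF reg t c] unfolding has_vector_derivative_def V_def .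
    show "(Z has_derivative (\<lambda>h. h *\<^sub>R Z')) (at t within S)"
      using X unfolding has_vector_derivative_def Z_def Z'_def V_def x_def .
  qed (use x D2 t in \<open>simp_all add: x_def\<close>)
  moreover have "\<forall>\<^sub>F s in at t within S. A ((chart_map c \<circ> \<gamma>) s) (Z s) = field_in_chart d \<gamma> X s"
    using regular_curve_eventually[OF reg t chart_homeomorphism(1)[OF c(1)] c(2)]
      regular_curve_eventually[OF reg t chart_homeomorphism(1)[OF d(1)] d(2)]
    by eventually_elim (use c d in \<open>simp add: AT Z_def field_in_chart_change\<close>)
  ultimately have "(field_in_chart d \<gamma> X has_derivative
      (\<lambda>h. A ((chart_map c \<circ> \<gamma>) t) (h *\<^sub>R Z') + D2 (Z t) (h *\<^sub>R V))) (at t within S)"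
    by (rule has_derivative_transform_eventually) (use c d t in \<open>simp_all add: AT Z_def field_in_chart_change\<close>)
  moreover have "A ((chart_map c \<circ> \<gamma>) t) (h *\<^sub>R Z') + D2 (Z t) (h *\<^sub>R V)
      = h *\<^sub>R (tangent_change c d (\<gamma> t) Z' + D2 (Z t) V)" for h
    by (simp add: AT linear_scale[OF lin] linear_scale[OF has_derivative_linear[OF D2]] scaleR_add_right)
  moreover have "tangent_change c d (\<gamma> t) Z' + D2 (Z t) V =
      field_in_chart d \<gamma> Y t - christoffel M d (chart_map d (\<gamma> t))
        (field_in_chart d \<gamma> (velocity M S \<gamma>) t) (field_in_chart d \<gamma> X t)"
    using christoffel_transformation[OF c(1) d(1) c(2) d(2), of V "Z t"]
    by (simp add: Z'_def linear_diff[OF lin] ch x_def D2_def A_def V_def Z_def)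
  ultimately show ?thesis unfolding has_vector_derivative_def by simp
qed

text \<open>The covariant derivative at \<open>t\<close> is defined in the chart preferred at \<open>\<gamma> t\<close>, which jumps as \<open>t\<close>
  varies. Here it is expressed in one chart for all \<open>t\<close>, as needed for treating parallelism as a
  differential equation and for continuity of the velocity.\<close>

lemma has_covariant_derivative_in_chart:
  assumes reg: "regular_curve S \<gamma>" and t: "t \<in> S" and c: "c \<in> atlas M" "\<gamma> t \<in> chart_dom c"
  shows "has_covariant_derivative M S \<gamma> X (Y t) t \<longleftrightarrow>
    (field_in_chart c \<gamma> X has_vector_derivative
      field_in_chart c \<gamma> Y t - christoffel M c (chart_map c (\<gamma> t))
        (field_in_chart c \<gamma> (velocity M S \<gamma>) t) (field_in_chart c \<gamma> X t)) (at t within S)"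
    (is "_ \<longleftrightarrow> ?in_chart c")
proof -
  have "has_covariant_derivative M S \<gamma> X (Y t) t \<longleftrightarrow> ?in_chart (chart_at M (\<gamma> t))"
    unfolding has_covariant_derivative_def Let_def field_in_chart_at
    by (simp add: field_in_chart_def[abs_def])
  then show ?thesis
    using covariant_derivative_change_chart[OF reg t] c chart_at by blast
qed

lemma field_in_chart_zero:
  assumes "c \<in> atlas M" "\<gamma> t \<in> chart_dom c"
  shows "field_in_chart c \<gamma> (\<lambda>_. 0) t = 0"
  unfolding field_in_chart_def by (rule linear_0[OF linear_tangent_change]) (use assms in auto)

text \<open>In coordinates the derivative has one term from each field, given by the equation of parallelism,
  and one from the metric; they cancel by metric compatibility.\<close>

lemma parallel_inner_has_derivative_0:
  assumes reg: "regular_curve S \<gamma>" and t: "t \<in> S"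
    and X: "has_covariant_derivative M S \<gamma> X 0 t" and Y: "has_covariant_derivative M S \<gamma> Y 0 t"
  shows "((\<lambda>s. rmetric M (\<gamma> s) (X s) (Y s)) has_real_derivative 0) (at t within S)"
proof -
  define c where "c = chart_at M (\<gamma> t)"
  have c: "c \<in> atlas M" "\<gamma> t \<in> chart_dom c" by (simp_all add: c_def)
  define x where "x = chart_map c (\<gamma> t)"
  have x: "x \<in> chart_image c" using c by (simp add: x_def)
  define V where "V = field_in_chart c \<gamma> (velocity M S \<gamma>) t"
  define P where "P = field_in_chart c \<gamma> X"
  define Q where "Q = field_in_chart c \<gamma> Y"
  note b = inner_formD(1)[OF inner_form_metric_in_chart[OF c(1) x]]
  note parallel = has_covariant_derivative_in_chart[OF reg t c, where Y = "\<lambda>_. 0", unfolded field_in_chart_zero[where t = t and \<gamma> = \<gamma>, OF c]]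
  have P: "(P has_derivative (\<lambda>h. h *\<^sub>R - christoffel M c x V (P t))) (at t within S)"
    using parallel X unfolding has_vector_derivative_def P_def V_def x_def by simp
  have Q: "(Q has_derivative (\<lambda>h. h *\<^sub>R - christoffel M c x V (Q t))) (at t within S)"
    using parallel Y unfolding has_vector_derivative_def Q_def V_def x_def by simp
  have "((\<lambda>s. metric_in_chart M c ((chart_map c \<circ> \<gamma>) s) (P s) (Q s)) has_derivative
      (\<lambda>h. metric_in_chart M c ((chart_map c \<circ> \<gamma>) t) (h *\<^sub>R - christoffel M c x V (P t)) (Q t)
        + metric_in_chart M c ((chart_map c \<circ> \<gamma>) t) (P t) (h *\<^sub>R - christoffel M c x V (Q t))
        + dmetric c x (P t) (Q t) (h *\<^sub>R V))) (at t within S)"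
  proof (rule has_derivative_bilinear_family[OF chart_homeomorphism(2)[OF c(1)] _ t])
    show "bilinear (metric_in_chart M c y)" if "y \<in> chart_image c" for y
      using inner_formD(1)[OF inner_form_metric_in_chart[OF c(1) that]] .
    show "((\<lambda>y. metric_in_chart M c y u v) has_derivative dmetric c x u v) (at ((chart_map c \<circ> \<gamma>) t))" for u v
      using has_derivative_metric[OF c(1) x] by (simp add: x_def)
    show "((chart_map c \<circ> \<gamma>) has_derivative (\<lambda>h. h *\<^sub>R V)) (at t within S)"
      using velocity_in_chart[OF reg t c] unfolding has_vector_derivative_def V_def .
  qed (use x P Q in \<open>simp_all add: x_def\<close>)
  moreover have "metric_in_chart M c ((chart_map c \<circ> \<gamma>) t) (h *\<^sub>R - christoffel M c x V (P t)) (Q t)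
        + metric_in_chart M c ((chart_map c \<circ> \<gamma>) t) (P t) (h *\<^sub>R - christoffel M c x V (Q t))
        + dmetric c x (P t) (Q t) (h *\<^sub>R V) = 0 * h" for h
    by (simp add: x_def[symmetric] bilinear_lmul[OF b] bilinear_rmul[OF b] bilinear_lneg[OF b] bilinear_rneg[OF b]
        linear_scale[OF linear_dmetric(1)[OF c(1) x]] metric_compatibility[OF c(1) x, symmetric]
        linear_scale[OF linear_christoffel(2)[OF c(1) x]] distrib_left)
  ultimately have "((\<lambda>s. metric_in_chart M c ((chart_map c \<circ> \<gamma>) s) (P s) (Q s)) has_derivative (*) 0)
      (at t within S)" by (simp add: lambda_zero)
  then have "((\<lambda>s. rmetric M (\<gamma> s) (X s) (Y s)) has_derivative (*) 0) (at t within S)"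
  proof (rule has_derivative_transform_eventually)
    have eq: "metric_in_chart M c ((chart_map c \<circ> \<gamma>) s) (P s) (Q s) = rmetric M (\<gamma> s) (X s) (Y s)"
      if "\<gamma> s \<in> chart_dom c" for s
      using rmetric_in_chart[OF c(1) that] by (simp add: P_def Q_def field_in_chart_def)
    show "\<forall>\<^sub>F s in at t within S. metric_in_chart M c ((chart_map c \<circ> \<gamma>) s) (P s) (Q s) = rmetric M (\<gamma> s) (X s) (Y s)"
      using regular_curve_eventually[OF reg t chart_homeomorphism(1)[OF c(1)] c(2)]
      by eventually_elim (rule eq)
    show "metric_in_chart M c ((chart_map c \<circ> \<gamma>) t) (P t) (Q t) = rmetric M (\<gamma> t) (X t) (Y t)"
      by (rule eq[OF c(2)])
  qed (rule t)
  then show ?thesis unfolding has_field_derivative_def .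
qed

lemma parallel_inner_constant:
  assumes reg: "regular_curve S \<gamma>" and S: "convex S" "s \<in> S" "t \<in> S"
    and "parallel_along M S \<gamma> X" "parallel_along M S \<gamma> Y"
  shows "rmetric M (\<gamma> s) (X s) (Y s) = rmetric M (\<gamma> t) (X t) (Y t)"
  using has_field_derivative_zero_constant[OF S(1), of "\<lambda>s. rmetric M (\<gamma> s) (X s) (Y s)"]
    parallel_inner_has_derivative_0[OF reg] assms unfolding parallel_along_def by metis

text \<open>Two parallel fields with the same initial value coincide, since the norm of their difference is
  constant. Expanding this norm makes it a matter of inner products of the given two fields only.\<close>

lemma parallel_transport_eq:
  assumes reg: "regular_curve {0..1} \<gamma>" and X: "parallel_along M {0..1} \<gamma> X"
  shows "parallel_transport M \<gamma> (X 0) = X 1"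
  unfolding parallel_transport_def
proof (rule the_equality)
  fix w assume "\<exists>Y. parallel_along M {0..1} \<gamma> Y \<and> Y 0 = X 0 \<and> Y 1 = w"
  then obtain Y where Y: "parallel_along M {0..1} \<gamma> Y" "Y 0 = X 0" "Y 1 = w" by blast
  note b = inner_formD(1)[OF inner_form_rmetric]
  have const: "rmetric M (\<gamma> 1) (A 1) (B 1) = rmetric M (\<gamma> 0) (A 0) (B 0)"
    if "parallel_along M {0..1} \<gamma> A" "parallel_along M {0..1} \<gamma> B" for A B
    by (rule parallel_inner_constant[OF reg _ _ _ that]) auto
  have "rmetric M (\<gamma> 1) (Y 1 - X 1) (Y 1 - X 1) = 0"
    using const[OF X X] const[OF X Y(1)] const[OF Y(1) X] const[OF Y(1) Y(1)] Y(2)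
    by (simp add: bilinear_lsub[OF b] bilinear_rsub[OF b])
  then show "w = X 1"
    using inner_formD(3)[OF inner_form_rmetric, of "Y 1 - X 1" "\<gamma> 1"] Y(3) by fastforce
qed (use X in blast)

text \<open>In a chart that contains the whole curve, parallelism is a linear differential equation with
  continuous coefficients.\<close>

lemma parallel_field_exists:
  assumes reg: "regular_curve {0..1} \<gamma>" and c: "c \<in> atlas M" "\<And>t. t \<in> {0..1} \<Longrightarrow> \<gamma> t \<in> chart_dom c"
    and cont: "continuous_on {0..1} (field_in_chart c \<gamma> (velocity M {0..1} \<gamma>))"
  obtains X where "parallel_along M {0..1} \<gamma> X" "X 0 = v"
proof -
  define V where "V = field_in_chart c \<gamma> (velocity M {0..1} \<gamma>)"
  define x where "x t = chart_map c (\<gamma> t)" for t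
  have x: "x t \<in> chart_image c" if "t \<in> {0..1}" for t using c(2)[OF that] by (simp add: x_def)
  have "continuous_on {0..1} (chart_map c \<circ> \<gamma>)"
    unfolding continuous_on_eq_continuous_within
    by (intro ballI has_vector_derivative_continuous[OF velocity_in_chart[OF reg _ c(1) c(2)]])
  then have contx: "continuous_on {0..1} x" by (simp add: x_def[abs_def] o_def)
  define A where "A t w = - christoffel M c (x t) (V t) w" for t w
  have lin: "linear (A t)" if "t \<in> {0..1}" for t
    unfolding A_def using linear_christoffel(1)[OF c(1) x[OF that]] by (rule linear_compose_neg)
  have contA: "continuous_on {0..1} (\<lambda>t. A t w)" for w
  proof -
    have "continuous_on {0..1} (\<lambda>t. - (\<Sum>b\<in>Basis. (V t \<bullet> b) *\<^sub>R christoffel M c (x t) b w))"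
      using cont x unfolding V_def[symmetric]
      by (intro continuous_intros continuous_on_compose2[OF continuous_christoffel[OF c(1)] contx]) auto
    then show ?thesis
      unfolding A_def
      by (rule continuous_on_eq)
        (rule arg_cong[where f = uminus], rule linear_representation[OF linear_christoffel(2)[OF c(1) x], symmetric])
  qed
  obtain Z where Z: "Z 0 = tangent_change (chart_at M (\<gamma> 0)) c (\<gamma> 0) v"
      "\<And>t. t \<in> {0..1} \<Longrightarrow> (Z has_vector_derivative A t (Z t)) (at t within {0..1})"
    using linear_ode_solution_exists[OF lin contA] by blast
  define X where "X t = tangent_change c (chart_at M (\<gamma> t)) (\<gamma> t) (Z t)" for t
  have XZ: "field_in_chart c \<gamma> X t = Z t" if "t \<in> {0..1}" for t
    unfolding field_in_chart_def X_def using c(1) c(2)[OF that] by (simp add: tangent_change_inverse)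
  show ?thesis
  proof
    show "X 0 = v" unfolding X_def Z(1) using c by (simp add: tangent_change_inverse)
    show "parallel_along M {0..1} \<gamma> X"
      unfolding parallel_along_def
    proof
      fix t :: real assume t: "t \<in> {0..1}"
      have "(field_in_chart c \<gamma> X has_vector_derivative A t (Z t)) (at t within {0..1})"
        by (rule has_vector_derivative_transform[OF t XZ Z(2)[OF t]])
      then show "has_covariant_derivative M {0..1} \<gamma> X 0 t"
        using has_covariant_derivative_in_chart[OF reg t c(1) c(2)[OF t], of X "\<lambda>_. 0"]
        by (simp add: field_in_chart_zero[where t = t and \<gamma> = \<gamma>, OF c(1) c(2)[OF t]] XZ[OF t] A_def V_def x_def)
    qed
  qed
qed

section \<open>Geodesics\<close>

lemma geodesic_regular_curve:
  assumes "geodesic_on M S \<gamma>" "\<And>t. t \<in> S \<Longrightarrow> at t within S \<noteq> bot"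
  shows "regular_curve S \<gamma>"
  using assms unfolding geodesic_on_def regular_curve_def by blast

text \<open>In a fixed chart the geodesic equation even makes the velocity differentiable. This provides the
  continuous coefficients that the equation of parallelism needs.\<close>

lemma geodesic_velocity_continuous:
  assumes reg: "regular_curve S \<gamma>" and geo: "geodesic_on M S \<gamma>"
    and c: "c \<in> atlas M" "\<And>t. t \<in> S \<Longrightarrow> \<gamma> t \<in> chart_dom c"
  shows "continuous_on S (field_in_chart c \<gamma> (velocity M S \<gamma>))"
  unfolding continuous_on_eq_continuous_within
proof
  fix t assume t: "t \<in> S"
  have "has_covariant_derivative M S \<gamma> (velocity M S \<gamma>) 0 t"
    using geo t unfolding geodesic_on_def parallel_along_def by blast
  then show "continuous (at t within S) (field_in_chart c \<gamma> (velocity M S \<gamma>))"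
    using has_covariant_derivative_in_chart[OF reg t c(1) c(2)[OF t], of _ "\<lambda>_. 0"]
    by (auto intro: has_vector_derivative_continuous)
qed

lemma geodesic_constant_speed:
  assumes "regular_curve S \<gamma>" "geodesic_on M S \<gamma>" "convex S" "s \<in> S" "t \<in> S"
  shows "rnorm M (\<gamma> s) (velocity M S \<gamma> s) = rnorm M (\<gamma> t) (velocity M S \<gamma> t)"
  unfolding rnorm_def
  using parallel_inner_constant[OF assms(1,3,4,5)] assms(2) unfolding geodesic_on_def by metis

lemma unit_interval_nontrivial: "t \<in> {0..1::real} \<Longrightarrow> at t within {0..1} \<noteq> bot"
  using trivial_limit_within islimpt_Icc by (metis zero_less_one)

text \<open>Affine changes of parameter preserve geodesics: second derivatives scale by \<open>h\<^sup>2\<close>, and so does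
  the Christoffel term, being quadratic in the velocity.\<close>

lemma geodesic_reparametrization:
  fixes a h :: real
  defines "r \<equiv> \<lambda>s. a + h * s"
  assumes geo: "geodesic_on M UNIV \<gamma>"
  shows "geodesic_on M {0..1} (\<gamma> \<circ> r)"
    and "s \<in> {0..1} \<Longrightarrow> velocity M {0..1} (\<gamma> \<circ> r) s = h *\<^sub>R velocity M UNIV \<gamma> (r s)"
proof -
  have reg: "regular_curve UNIV \<gamma>" using geo by (rule geodesic_regular_curve) simp
  have r: "(r has_vector_derivative h) (at s within S)" for s S
    unfolding r_def by (auto intro!: derivative_eq_intros)
  have contr: "continuous_on S r" for S unfolding r_def by (intro continuous_intros)
  have chain: "((f \<circ> r) has_vector_derivative h *\<^sub>R f') (at s within {0..1})"
    if "(f has_vector_derivative f') (at (r s))" for f :: "real \<Rightarrow> 'e" and f' s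
    by (rule vector_diff_chain_within[OF r has_vector_derivative_at_within[OF that]])
  have vel: "((chart_map (chart_at M ((\<gamma> \<circ> r) s)) \<circ> (\<gamma> \<circ> r)) has_vector_derivative h *\<^sub>R velocity M UNIV \<gamma> (r s))
      (at s within {0..1})" for s
    using chain[OF velocity_in_chart[OF reg, of "r s" "chart_at M (\<gamma> (r s))"]] by (simp add: o_assoc)
  show v: "velocity M {0..1} (\<gamma> \<circ> r) s = h *\<^sub>R velocity M UNIV \<gamma> (r s)" if "s \<in> {0..1}" for s
    unfolding velocity_def[of M "{0..1}"]
    by (rule vector_derivative_within[OF unit_interval_nontrivial[OF that] vel])
  have cov: "has_covariant_derivative M {0..1} (\<gamma> \<circ> r) (velocity M {0..1} (\<gamma> \<circ> r)) 0 s" if s: "s \<in> {0..1}" for s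
  proof -
    define c where "c = chart_at M (\<gamma> (r s))"
    have c: "c \<in> atlas M" "\<gamma> (r s) \<in> chart_dom c" by (simp_all add: c_def)
    have x: "chart_map c (\<gamma> (r s)) \<in> chart_image c" using c by simp
    let ?V = "velocity M UNIV \<gamma>"
    have "has_covariant_derivative M UNIV \<gamma> ?V 0 (r s)"
      using geo unfolding geodesic_on_def parallel_along_def by blast
    then have "(field_in_chart c \<gamma> ?V has_vector_derivative
        - christoffel M c (chart_map c (\<gamma> (r s))) (?V (r s)) (?V (r s))) (at (r s))"
      unfolding has_covariant_derivative_def Let_def c_def field_in_chart_def[abs_def] by simp
    note chain[OF this]
    from has_vector_derivative_scaleR[OF DERIV_const this]
    have "((\<lambda>s. h *\<^sub>R (field_in_chart c \<gamma> ?V \<circ> r) s) has_vector_derivative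
        h *\<^sub>R h *\<^sub>R - christoffel M c (chart_map c (\<gamma> (r s))) (?V (r s)) (?V (r s))) (at s within {0..1})"
      by simp
    moreover have "h *\<^sub>R h *\<^sub>R - christoffel M c (chart_map c (\<gamma> (r s))) (?V (r s)) (?V (r s)) =
       0 - christoffel M c (chart_map c ((\<gamma> \<circ> r) s)) (velocity M {0..1} (\<gamma> \<circ> r) s) (velocity M {0..1} (\<gamma> \<circ> r) s)"
      unfolding v[OF s]
      by (simp add: linear_scale[OF linear_christoffel(1)[OF c(1) x]] linear_scale[OF linear_christoffel(2)[OF c(1) x]])
    ultimately have *: "((\<lambda>s. h *\<^sub>R (field_in_chart c \<gamma> ?V \<circ> r) s) has_vector_derivative
       0 - christoffel M c (chart_map c ((\<gamma> \<circ> r) s)) (velocity M {0..1} (\<gamma> \<circ> r) s) (velocity M {0..1} (\<gamma> \<circ> r) s))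
         (at s within {0..1})" by simp
    have eq: "h *\<^sub>R (field_in_chart c \<gamma> ?V \<circ> r) s'
        = tangent_change (chart_at M ((\<gamma> \<circ> r) s')) c ((\<gamma> \<circ> r) s') (velocity M {0..1} (\<gamma> \<circ> r) s')"
      if "s' \<in> {0..1}" "\<gamma> (r s') \<in> chart_dom c" for s'
      unfolding v[OF that(1)]
      unfolding field_in_chart_def comp_def
      using linear_scale[OF linear_tangent_change[of "chart_at M (\<gamma> (r s'))" c "\<gamma> (r s')"]] c that
      by simp
    have "continuous_on {0..1} (\<gamma> \<circ> r)"
      using reg contr unfolding regular_curve_def by (blast intro: continuous_on_compose continuous_on_subset)
    then have "((\<gamma> \<circ> r) \<longlongrightarrow> (\<gamma> \<circ> r) s) (at s within {0..1})" using s unfolding continuous_on_def by blast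
    then have "\<forall>\<^sub>F s' in at s within {0..1}. (\<gamma> \<circ> r) s' \<in> chart_dom c"
      by (rule topological_tendstoD) (use c chart_homeomorphism(1)[OF c(1)] in auto)
    moreover have "\<forall>\<^sub>F s' in at s within {0..1}. s' \<in> {0..1}" by (simp add: eventually_at_filter)
    ultimately have "\<forall>\<^sub>F s' in at s within {0..1}. h *\<^sub>R (field_in_chart c \<gamma> ?V \<circ> r) s'
        = tangent_change (chart_at M ((\<gamma> \<circ> r) s')) c ((\<gamma> \<circ> r) s') (velocity M {0..1} (\<gamma> \<circ> r) s')"
      by eventually_elim (rule eq, auto)
    from has_derivative_transform_eventually[OF *[unfolded has_vector_derivative_def] this eq[OF s c(2)] s]
    show ?thesis
      unfolding has_covariant_derivative_def Let_def has_vector_derivative_def c_def comp_def .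
  qed
  show "geodesic_on M {0..1} (\<gamma> \<circ> r)"
    unfolding geodesic_on_def parallel_along_def
  proof (intro conjI ballI cov)
    show "continuous_on {0..1} (\<gamma> \<circ> r)"
      using reg contr unfolding regular_curve_def by (blast intro: continuous_on_compose continuous_on_subset)
    show "chart_map (chart_at M ((\<gamma> \<circ> r) s)) \<circ> (\<gamma> \<circ> r) differentiable at s within {0..1}" for s
      using vel[of s] unfolding has_vector_derivative_def differentiable_def by blast
  qed
qed

section \<open>Descent along geodesics\<close>

lemma rnorm_power2: "(rnorm M p v)\<^sup>2 = rmetric M p v v"
  unfolding rnorm_def using inner_formD(4)[OF inner_form_rmetric] by simp

lemma rnorm_nonneg: "0 \<le> rnorm M p v"
  unfolding rnorm_def using inner_formD(4)[OF inner_form_rmetric] by simp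

lemma rnorm_scaleR: "rnorm M p (h *\<^sub>R v) = \<bar>h\<bar> * rnorm M p v"
proof -
  note b = inner_formD(1)[OF inner_form_rmetric]
  have "rmetric M p (h *\<^sub>R v) (h *\<^sub>R v) = h\<^sup>2 * rmetric M p v v"
    by (simp add: bilinear_lmul[OF b] bilinear_rmul[OF b] power2_eq_square)
  then show ?thesis unfolding rnorm_def by (simp add: real_sqrt_mult)
qed

definition chartwise_differentiable :: "('a \<Rightarrow> real) \<Rightarrow> bool" where
  "chartwise_differentiable f \<longleftrightarrow>
     (\<forall>c\<in>atlas M. \<forall>x\<in>chart_image c. (f \<circ> chart_inv c) differentiable (at x))"

lemma has_derivative_differential_at:
  assumes "chartwise_differentiable f"
  shows "((f \<circ> chart_inv (chart_at M p)) has_derivative differential_at M f p)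
    (at (chart_map (chart_at M p) p))"
  using assms unfolding chartwise_differentiable_def differential_at_def Let_def
  by (metis chart_at chart_map_in_image frechet_derivative_works)

lemma rmetric_grad:
  assumes "chartwise_differentiable f"
  shows "rmetric M p (grad M f p) v = differential_at M f p v"
  using theI'[OF inner_form_Riesz[OF inner_form_rmetric
        has_derivative_linear[OF has_derivative_differential_at[OF assms]]]]
  unfolding grad_def by blast

lemma derivative_along_curve:
  assumes f: "chartwise_differentiable f" and reg: "regular_curve S \<gamma>" and t: "t \<in> S"
  shows "((\<lambda>s. f (\<gamma> s)) has_real_derivative rmetric M (\<gamma> t) (grad M f (\<gamma> t)) (velocity M S \<gamma> t))
    (at t within S)"
proof -
  define c where "c = chart_at M (\<gamma> t)"
  have c: "c \<in> atlas M" "\<gamma> t \<in> chart_dom c" by (simp_all add: c_def)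
  have "((chart_map c \<circ> \<gamma>) has_derivative (\<lambda>h. h *\<^sub>R velocity M S \<gamma> t)) (at t within S)"
    using velocity_in_chart[OF reg t c] unfolding has_vector_derivative_def by (simp add: c_def)
  from has_derivative_compose[OF this, of "f \<circ> chart_inv c" "differential_at M f (\<gamma> t)"]
  have "((\<lambda>s. (f \<circ> chart_inv c) ((chart_map c \<circ> \<gamma>) s)) has_derivative
      (\<lambda>h. differential_at M f (\<gamma> t) (h *\<^sub>R velocity M S \<gamma> t))) (at t within S)"
    using has_derivative_differential_at[OF f, of "\<gamma> t"] by (simp add: c_def)
  then have "((\<lambda>s. f (\<gamma> s)) has_derivative
      (\<lambda>h. differential_at M f (\<gamma> t) (h *\<^sub>R velocity M S \<gamma> t))) (at t within S)"
  proof (rule has_derivative_transform_eventually)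
    show "\<forall>\<^sub>F s in at t within S. (f \<circ> chart_inv c) ((chart_map c \<circ> \<gamma>) s) = f (\<gamma> s)"
      using regular_curve_eventually[OF reg t chart_homeomorphism(1)[OF c(1)] c(2)]
      by eventually_elim (use c in simp)
  qed (use c t in simp_all)
  moreover have "differential_at M f (\<gamma> t) (h *\<^sub>R velocity M S \<gamma> t) =
      rmetric M (\<gamma> t) (grad M f (\<gamma> t)) (velocity M S \<gamma> t) * h" for h
    unfolding rmetric_grad[OF f]
    using linear_scale[OF has_derivative_linear[OF has_derivative_differential_at[OF f]]]
    by (simp add: mult.commute)
  ultimately show ?thesis unfolding has_field_derivative_def by simp
qed

text \<open>By the chain rule, this is the derivative of \<open>f \<circ> \<gamma>\<close> at \<open>\<tau>\<close>.\<close>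

definition slope :: "('a \<Rightarrow> real) \<Rightarrow> (real \<Rightarrow> 'a) \<Rightarrow> real \<Rightarrow> real" where
  "slope f \<gamma> \<tau> = rmetric M (\<gamma> \<tau>) (grad M f (\<gamma> \<tau>)) (velocity M UNIV \<gamma> \<tau>)"

definition lipschitz_gradient :: "('a \<Rightarrow> real) \<Rightarrow> real \<Rightarrow> bool" where
  "lipschitz_gradient f K \<longleftrightarrow> (\<forall>p q. \<forall>\<gamma> \<in> geodesic_segments M p q.
     rnorm M q (parallel_transport M \<gamma> (grad M f p) - grad M f q) \<le> K * curve_length M \<gamma>)"

text \<open>The geometric core of the descent estimate: the gradient at \<open>\<gamma> a\<close> is transported to \<open>\<gamma> b\<close>, where it is
  compared with the gradient there in the direction of the geodesic. The segment is rescaled to the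
  unit interval, so its speed and its length are both \<open>b - a\<close> times the speed of \<open>\<gamma>\<close>.\<close>

lemma slope_difference_in_chart:
  assumes lip: "lipschitz_gradient f K" and geo: "geodesic_on M UNIV \<gamma>" and ab: "a < b"
    and c: "c \<in> atlas M" "\<And>\<tau>. \<tau> \<in> {a..b} \<Longrightarrow> \<gamma> \<tau> \<in> chart_dom c"
  shows "slope f \<gamma> b - slope f \<gamma> a \<le> K * (rnorm M (\<gamma> 0) (velocity M UNIV \<gamma> 0))\<^sup>2 * (b - a)"
proof -
  define h where "h = b - a"
  have h: "0 < h" using ab by (simp add: h_def)
  define r where "r s = a + h * s" for s
  define \<sigma> where "\<sigma> = \<gamma> \<circ> r"
  define w where "w = rnorm M (\<gamma> 0) (velocity M UNIV \<gamma> 0)"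
  have r01: "r 0 = a" "r 1 = b" by (simp_all add: r_def h_def)
  have r_mem: "r s \<in> {a..b}" if "s \<in> {0..1}" for s
  proof -
    have "0 \<le> h * s" "h * s \<le> h * 1" using that h by (auto intro: mult_left_mono)
    then show ?thesis unfolding r_def by (simp add: h_def)
  qed
  have geo\<sigma>: "geodesic_on M {0..1} \<sigma>"
    and vel: "\<And>s. s \<in> {0..1} \<Longrightarrow> velocity M {0..1} \<sigma> s = h *\<^sub>R velocity M UNIV \<gamma> (r s)"
    using geodesic_reparametrization[OF geo, where a = a and h = h] by (simp_all add: \<sigma>_def r_def[abs_def])
  have reg: "regular_curve {0..1} \<sigma>"
    by (rule geodesic_regular_curve[OF geo\<sigma> unit_interval_nontrivial])
  have regU: "regular_curve UNIV \<gamma>" using geo by (rule geodesic_regular_curve) simp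
  have in_c: "\<sigma> s \<in> chart_dom c" if "s \<in> {0..1}" for s
    using c(2)[OF r_mem[OF that]] by (simp add: \<sigma>_def)
  have seg: "\<sigma> \<in> geodesic_segments M (\<gamma> a) (\<gamma> b)"
    unfolding geodesic_segments_def using geo\<sigma> by (simp add: \<sigma>_def r01)
  have speed: "rnorm M (\<sigma> s) (velocity M {0..1} \<sigma> s) = h * w" if "s \<in> {0..1}" for s
    using geodesic_constant_speed[OF regU geo convex_UNIV, of "r s" 0] h
    unfolding vel[OF that] rnorm_scaleR by (simp add: \<sigma>_def w_def)
  have "curve_length M \<sigma> = integral {0..1} (\<lambda>_::real. h * w)"
    unfolding curve_length_def by (rule Henstock_Kurzweil_Integration.integral_cong) (rule speed)
  then have len: "curve_length M \<sigma> = h * w" by simp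
  obtain X where X: "parallel_along M {0..1} \<sigma> X" "X 0 = grad M f (\<gamma> a)"
    using parallel_field_exists[OF reg c(1) in_c geodesic_velocity_continuous[OF reg geo\<sigma> c(1) in_c]]
    by blast
  have pt: "parallel_transport M \<sigma> (grad M f (\<gamma> a)) = X 1"
    using parallel_transport_eq[OF reg X(1)] X(2) by simp
  have par_vel: "parallel_along M {0..1} \<sigma> (velocity M {0..1} \<sigma>)"
    using geo\<sigma> unfolding geodesic_on_def by blast
  note bil = inner_formD(1)[OF inner_form_rmetric]
  let ?v = "velocity M {0..1} \<sigma> 1"
  \<comment> \<open>Transport along a geodesic preserves the inner product with the velocity.\<close>
  have "rmetric M (\<gamma> b) (X 1) ?v = rmetric M (\<gamma> a) (grad M f (\<gamma> a)) (velocity M {0..1} \<sigma> 0)"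
    using parallel_inner_constant[OF reg _ _ _ X(1) par_vel, of 1 0] X(2)
    by (simp add: \<sigma>_def r01)
  also have "\<dots> = h * slope f \<gamma> a"
    by (simp add: vel r01 slope_def bilinear_rmul[OF bil])
  finally have start: "rmetric M (\<gamma> b) (X 1) ?v = h * slope f \<gamma> a" .
  have "h * (slope f \<gamma> b - slope f \<gamma> a) = rmetric M (\<gamma> b) (grad M f (\<gamma> b)) ?v - rmetric M (\<gamma> b) (X 1) ?v"
    unfolding start by (simp add: vel r01 slope_def bilinear_rmul[OF bil] right_diff_distrib)
  also have "\<dots> = rmetric M (\<gamma> b) (X 1 - grad M f (\<gamma> b)) ((-1) *\<^sub>R ?v)"
    by (simp add: bilinear_lsub[OF bil] bilinear_rneg[OF bil])
  also have "\<dots> \<le> rnorm M (\<gamma> b) (X 1 - grad M f (\<gamma> b)) * rnorm M (\<gamma> b) ((-1) *\<^sub>R ?v)"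
    unfolding rnorm_def by (rule inner_form_Cauchy_Schwarz[OF inner_form_rmetric])
  also have "\<dots> \<le> (K * (h * w)) * (h * w)"
  proof (rule mult_mono)
    have sp1: "rnorm M (\<gamma> b) ?v = h * w" using speed[of 1] by (simp add: \<sigma>_def r01)
    show "rnorm M (\<gamma> b) ((-1) *\<^sub>R ?v) \<le> h * w" unfolding rnorm_scaleR sp1 by simp
    show *: "rnorm M (\<gamma> b) (X 1 - grad M f (\<gamma> b)) \<le> K * (h * w)"
      using lip seg unfolding lipschitz_gradient_def pt[symmetric] len[symmetric] by blast
    show "0 \<le> K * (h * w)" by (rule order_trans[OF rnorm_nonneg *])
  qed (rule rnorm_nonneg)
  also have "\<dots> = h * (K * w\<^sup>2 * h)" by (simp add: power2_eq_square)
  finally show ?thesis using h by (simp add: w_def h_def)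
qed

text \<open>Both sides are additive over adjacent intervals, and every parameter has a neighbourhood that is
  mapped into a single chart, so bisection extends the previous bound to all of \<open>\<gamma>\<close>.\<close>

lemma slope_difference:
  assumes lip: "lipschitz_gradient f K" and geo: "geodesic_on M UNIV \<gamma>" and "0 \<le> \<tau>"
  shows "slope f \<gamma> \<tau> - slope f \<gamma> 0 \<le> K * (rnorm M (\<gamma> 0) (velocity M UNIV \<gamma> 0))\<^sup>2 * (\<tau> - 0)"
proof -
  define C where "C = K * (rnorm M (\<gamma> 0) (velocity M UNIV \<gamma> 0))\<^sup>2"
  have "slope f \<gamma> \<tau> - slope f \<gamma> 0 \<le> C * (\<tau> - 0)"
    using \<open>0 \<le> \<tau>\<close>
  proof (induction rule: Bolzano)
    case (trans a b c)
    then show ?case by (simp add: algebra_simps)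
  next
    case (local x)
    define c where "c = chart_at M (\<gamma> x)"
    have c: "c \<in> atlas M" "\<gamma> x \<in> chart_dom c" by (simp_all add: c_def)
    have regU: "regular_curve UNIV \<gamma>" using geo by (rule geodesic_regular_curve) simp
    have "\<forall>\<^sub>F y in at x. \<gamma> y \<in> chart_dom c"
      using regular_curve_eventually[OF regU _ chart_homeomorphism(1)[OF c(1)] c(2)] by simp
    then obtain d where d: "0 < d" "\<And>y. y \<noteq> x \<Longrightarrow> dist y x < d \<Longrightarrow> \<gamma> y \<in> chart_dom c"
      unfolding eventually_at by auto
    show ?case
    proof (intro exI[of _ d] conjI allI impI d(1))
      fix a b assume ab: "a \<le> x \<and> x \<le> b \<and> b - a < d"
      show "slope f \<gamma> b - slope f \<gamma> a \<le> C * (b - a)"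
      proof (cases "a = b")
        case False
        show ?thesis
        proof (rule slope_difference_in_chart[OF lip geo _ c(1), folded C_def])
          show "a < b" using ab False by simp
          fix y assume "y \<in> {a..b}"
          then have "dist y x < d" using ab by (auto simp: dist_real_def)
          then show "\<gamma> y \<in> chart_dom c" using d(2)[of y] c(2) by blast
        qed
      qed simp
    qed
  qed
  then show ?thesis unfolding C_def .
qed

text \<open>Integrating the bound on the slope: \<open>f (\<gamma> \<tau>)\<close> minus its quadratic upper model is nonincreasing
  in \<open>\<tau>\<close>.\<close>

lemma exp_map_descent:
  assumes complete: "geodesically_complete M" and f: "chartwise_differentiable f"
    and lip: "lipschitz_gradient f K"
  shows "f (exp_map M p v) \<le> f p + rmetric M p (grad M f p) v + K / 2 * (rnorm M p v)\<^sup>2"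
proof -
  define \<gamma> where "\<gamma> = (SOME \<gamma>. geodesic_on M UNIV \<gamma> \<and> \<gamma> 0 = p \<and> velocity M UNIV \<gamma> 0 = v)"
  have "\<exists>\<gamma>. geodesic_on M UNIV \<gamma> \<and> \<gamma> 0 = p \<and> velocity M UNIV \<gamma> 0 = v"
    using complete unfolding geodesically_complete_def by blast
  from someI_ex[OF this] have "geodesic_on M UNIV \<gamma> \<and> \<gamma> 0 = p \<and> velocity M UNIV \<gamma> 0 = v"
    unfolding \<gamma>_def .
  then have geo: "geodesic_on M UNIV \<gamma>" and init: "\<gamma> 0 = p" "velocity M UNIV \<gamma> 0 = v" by auto
  have regU: "regular_curve UNIV \<gamma>" using geo by (rule geodesic_regular_curve) simp
  define w where "w = rnorm M p v"
  let ?\<psi> = "\<lambda>\<tau>. f (\<gamma> \<tau>) - slope f \<gamma> 0 * \<tau> - K * w\<^sup>2 * \<tau>\<^sup>2 / 2"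
  have "?\<psi> 1 \<le> ?\<psi> 0"
  proof (rule DERIV_nonpos_imp_nonincreasing[of 0 1 ?\<psi>])
    fix \<tau> :: real assume \<tau>: "0 \<le> \<tau>" "\<tau> \<le> 1"
    have "((\<lambda>\<tau>. f (\<gamma> \<tau>)) has_real_derivative slope f \<gamma> \<tau>) (at \<tau>)"
      unfolding slope_def using derivative_along_curve[OF f regU] by simp
    then have "(?\<psi> has_real_derivative slope f \<gamma> \<tau> - slope f \<gamma> 0 - K * w\<^sup>2 * \<tau>) (at \<tau>)"
      by (auto intro!: derivative_eq_intros)
    moreover have "slope f \<gamma> \<tau> - slope f \<gamma> 0 - K * w\<^sup>2 * \<tau> \<le> 0"
      using slope_difference[OF lip geo \<tau>(1)] by (simp add: init w_def)
    ultimately show "\<exists>y. (?\<psi> has_real_derivative y) (at \<tau>) \<and> y \<le> 0" by blast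
  qed simp
  moreover have "exp_map M p v = \<gamma> 1" unfolding exp_map_def \<gamma>_def ..
  ultimately show ?thesis by (simp add: init slope_def w_def)
qed

end

section \<open>The steepest descent direction\<close>

lemma continuous_on_Max:
  fixes f :: "'i \<Rightarrow> 'p::topological_space \<Rightarrow> real"
  assumes "finite I" "I \<noteq> {}" "\<And>i. i \<in> I \<Longrightarrow> continuous_on S (f i)"
  shows "continuous_on S (\<lambda>x. MAX i\<in>I. f i x)"
  using assms by (induction I rule: finite_ne_induct) (auto intro!: continuous_on_max)

text \<open>The model vanishes at \<open>0\<close>, and outside a ball it is positive because the quadratic term dominates any
  single one of the linear terms; so it is enough to minimise over the ball.\<close>

lemma max_model_minimizer_exists:
  fixes g :: "'m::finite \<Rightarrow> 'e::euclidean_space"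
  assumes B: "inner_form B"
  obtains v where "\<And>u. (MAX i. B (g i) v) + 1/2 * B v v \<le> (MAX i. B (g i) u) + 1/2 * B u u"
proof -
  define \<phi> where "\<phi> v = (MAX i. B (g i) v) + 1/2 * B v v" for v
  note b = inner_formD(1)[OF B]
  have cont: "continuous_on S \<phi>" for S
    unfolding \<phi>_def
    by (intro continuous_intros continuous_on_Max bilinear_continuous_on_compose[OF _ _ b]) auto
  have \<phi>0: "\<phi> 0 = 0" by (simp add: \<phi>_def bilinear_rzero[OF b])
  obtain c where c: "0 < c" "\<And>z. c * (norm z)\<^sup>2 \<le> B z z" using inner_form_coercive[OF B] by blast
  fix i0 :: 'm
  define G where "G = sqrt (B (g i0) (g i0))"
  define R where "R = sqrt (4 * G\<^sup>2 / c)"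
  \<comment> \<open>Only the linear term of \<open>i0\<close> is used; \<open>R\<close> comes from \<open>\<phi> u \<ge> - G n + n\<^sup>2 / 2\<close> with \<open>n\<^sup>2 = B u u\<close>.\<close>
  have outside: "norm u \<le> R" if "\<phi> u \<le> 0" for u
  proof -
    define n where "n = sqrt (B u u)"
    have n: "0 \<le> n" "n\<^sup>2 = B u u" using inner_formD(4)[OF B, of u] by (simp_all add: n_def)
    have "- B (g i0) u = B (g i0) (- u)" by (simp add: bilinear_rneg[OF b])
    also have "\<dots> \<le> G * n"
      using inner_form_Cauchy_Schwarz[OF B, of "g i0" "- u"]
      by (simp add: G_def n_def bilinear_rneg[OF b] bilinear_lneg[OF b])
    finally have "- (G * n) \<le> B (g i0) u" by simp
    also have "\<dots> \<le> (MAX i. B (g i) u)" by (intro Max_ge) auto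
    finally have "B u u \<le> 2 * (G * n)" using that by (simp add: \<phi>_def)
    then have "n * n \<le> n * (2 * G)"
      unfolding n(2)[symmetric] by (simp add: power2_eq_square algebra_simps)
    moreover have "0 \<le> G" using inner_formD(4)[OF B] by (simp add: G_def)
    ultimately have "n \<le> 2 * G" using n(1) by (cases "n = 0") (auto simp: mult_le_cancel_left)
    then have "n\<^sup>2 \<le> (2 * G)\<^sup>2" using n(1) by (rule power_mono)
    then have "c * (norm u)\<^sup>2 \<le> 4 * G\<^sup>2" using c(2)[of u] n(2) by (simp add: power_mult_distrib)
    then have "(norm u)\<^sup>2 \<le> 4 * G\<^sup>2 / c" using c(1) by (simp add: field_simps)
    then show ?thesis unfolding R_def by (rule real_le_rsqrt)
  qed
  have "0 \<in> cball (0::'e) R" using outside[of 0] \<phi>0 by simp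
  then obtain v where v: "v \<in> cball 0 R" "\<And>u. u \<in> cball 0 R \<Longrightarrow> \<phi> v \<le> \<phi> u"
    using continuous_attains_inf[OF compact_cball _ cont, of 0 R] by blast
  have "\<phi> v \<le> \<phi> u" for u
  proof (cases "u \<in> cball 0 R")
    case False
    then have "0 < \<phi> u" using outside[of u] by force
    then show ?thesis using v(2)[OF \<open>0 \<in> cball 0 R\<close>] \<phi>0 by simp
  qed (rule v(2))
  then show ?thesis using that unfolding \<phi>_def by blast
qed

text \<open>Compare the minimizer \<open>v\<close> with the shorter vectors \<open>(1 - d) v\<close>: this scales the linear part by
  \<open>1 - d\<close> and the quadratic part by \<open>(1 - d)\<^sup>2\<close>, and \<open>d \<rightarrow> 0\<close> gives the claim.\<close>

lemma max_model_minimizer_slope: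
  fixes g :: "'m::finite \<Rightarrow> 'e::euclidean_space"
  assumes B: "inner_form B"
    and v: "\<And>u. (MAX i. B (g i) v) + 1/2 * B v v \<le> (MAX i. B (g i) u) + 1/2 * B u u"
  shows "B (g i) v \<le> - B v v"
proof -
  note b = inner_formD(1)[OF B]
  define m where "m = (MAX i. B (g i) v)"
  define n where "n = B v v"
  have n: "0 \<le> n" using inner_formD(4)[OF B] by (simp add: n_def)
  have le_m: "B (g i) v \<le> m" for i unfolding m_def by (intro Max_ge) auto
  have shrink: "m \<le> - n + d * n / 2" if d: "0 < d" "d \<le> 1" for d
  proof -
    have "(MAX i. B (g i) ((1 - d) *\<^sub>R v)) \<le> (1 - d) * m"
      using d le_m by (auto simp: bilinear_rmul[OF b] intro!: mult_left_mono)
    moreover have "B ((1 - d) *\<^sub>R v) ((1 - d) *\<^sub>R v) = (1 - d)\<^sup>2 * n"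
      by (simp add: n_def bilinear_lmul[OF b] bilinear_rmul[OF b] power2_eq_square)
    ultimately have "m + 1/2 * n \<le> (1 - d) * m + 1/2 * ((1 - d)\<^sup>2 * n)"
      using v[of "(1 - d) *\<^sub>R v"] unfolding m_def[symmetric] n_def[symmetric] by linarith
    then have "d * m \<le> d * (- n + d * n / 2)" by (simp add: algebra_simps power2_eq_square)
    then show ?thesis using d(1) by simp
  qed
  have "m \<le> - n"
  proof (rule field_le_epsilon)
    fix e :: real assume e: "0 < e"
    define d where "d = min 1 (e / (n + 1))"
    have d: "0 < d" "d \<le> 1" using e n by (simp_all add: d_def)
    have "d * n \<le> e / (n + 1) * (n + 1)" using n e d by (intro mult_mono) (auto simp: d_def)
    then have "d * n \<le> e" using n by simp
    then show "m \<le> - n + e" using shrink[OF d] e by simp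
  qed
  then show ?thesis using le_m[of i] by (simp add: n_def)
qed

context riemannian
begin

lemma steepest_descent_slope:
  "rmetric M p (grad M (component F i) p) (steepest_descent_direction M F p)
     \<le> - (rnorm M p (steepest_descent_direction M F p))\<^sup>2"
proof -
  let ?\<phi> = "\<lambda>v. (MAX i. rmetric M p (grad M (component F i) p) v) + 1/2 * (rnorm M p v)\<^sup>2"
  obtain v where "\<And>u. ?\<phi> v \<le> ?\<phi> u"
    using max_model_minimizer_exists[OF inner_form_rmetric[of p], of "\<lambda>i. grad M (component F i) p"]
    unfolding rnorm_power2 by blast
  then have "is_arg_min ?\<phi> (\<lambda>_. True) v" unfolding is_arg_min_def by (simp add: not_less)
  then have "is_arg_min ?\<phi> (\<lambda>_. True) (steepest_descent_direction M F p)"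
    unfolding steepest_descent_direction_def arg_min_def by (rule someI)
  then have "?\<phi> (steepest_descent_direction M F p) \<le> ?\<phi> u" for u
    unfolding is_arg_min_def by (simp add: not_less)
  then show ?thesis
    unfolding rnorm_power2 by (rule max_model_minimizer_slope[OF inner_form_rmetric])
qed

lemma chartwise_differentiable_component:
  assumes "continuously_differentiable M F"
  shows "chartwise_differentiable (component F i)"
  unfolding chartwise_differentiable_def
proof (intro ballI)
  fix c x assume "c \<in> atlas M" "x \<in> chart_image c"
  then have "(F \<circ> chart_inv c) differentiable (at x)"
    using assms unfolding continuously_differentiable_def by simp
  then have "((F \<circ> chart_inv c) has_derivative frechet_derivative (F \<circ> chart_inv c) (at x)) (at x)"
    by (simp add: frechet_derivative_works)
  then have "((\<lambda>y. (F \<circ> chart_inv c) y $ i) has_derivative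
      (\<lambda>h. frechet_derivative (F \<circ> chart_inv c) (at x) h $ i)) (at x)"
    by (rule bounded_linear.has_derivative[OF bounded_linear_vec_nth])
  then show "(component F i \<circ> chart_inv c) differentiable (at x)"
    unfolding differentiable_def component_def comp_def by blast
qed

lemma sufficient_decrease_iff:
  "sufficient_decrease M F \<beta> p v s \<longleftrightarrow>
     (\<forall>i. component F i (exp_map M p (s *\<^sub>R v)) \<le> component F i p - \<beta> * s * (rnorm M p v)\<^sup>2)"
  by (simp add: sufficient_decrease_def component_def less_eq_vec_def)

lemma small_step_sufficient_decrease:
  fixes F :: "'a \<Rightarrow> real ^ 'm::finite"
  assumes complete: "geodesically_complete M" and F: "continuously_differentiable M F"
    and lip: "componentwise_lipschitz_gradient M F L" and L: "0 < L"
    and s: "0 < s" "s \<le> 2 * (1 - \<beta>) / L"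
  shows "sufficient_decrease M F \<beta> p (steepest_descent_direction M F p) s"
  unfolding sufficient_decrease_iff
proof
  fix i
  define v where "v = steepest_descent_direction M F p"
  define n where "n = (rnorm M p v)\<^sup>2"
  note b = inner_formD(1)[OF inner_form_rmetric]
  obtain Lc :: "'m \<Rightarrow> real" where Lc: "\<And>i. lipschitz_gradient (component F i) (Lc i)" "L = (MAX i. Lc i)"
    using lip unfolding componentwise_lipschitz_gradient_def lipschitz_gradient_def by blast
  have "Lc i \<le> L" unfolding Lc(2) by (intro Max_ge) auto
  have n: "0 \<le> n" by (simp add: n_def)
  have "component F i (exp_map M p (s *\<^sub>R v)) \<le> component F i p
      + rmetric M p (grad M (component F i) p) (s *\<^sub>R v) + Lc i / 2 * (rnorm M p (s *\<^sub>R v))\<^sup>2"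
    by (rule exp_map_descent[OF complete chartwise_differentiable_component[OF F] Lc(1)])
  also have "\<dots> = component F i p + s * rmetric M p (grad M (component F i) p) v + Lc i / 2 * (s\<^sup>2 * n)"
    by (simp add: bilinear_rmul[OF b] rnorm_scaleR n_def power_mult_distrib)
  also have "\<dots> \<le> component F i p + s * (- n) + L / 2 * (s\<^sup>2 * n)"
    using s(1) n \<open>Lc i \<le> L\<close> steepest_descent_slope[of p F i]
    by (intro add_mono mult_left_mono mult_right_mono) (auto simp: n_def v_def)
  also have "\<dots> = component F i p - s * n * (1 - L * s / 2)" by (simp add: algebra_simps power2_eq_square)
  also have "\<dots> \<le> component F i p - s * n * \<beta>"
    using s L n by (intro diff_left_mono mult_left_mono) (auto simp: field_simps)
  also have "s * n * \<beta> = \<beta> * s * n" by (simp only: mult_ac)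
  finally show "component F i (exp_map M p (s *\<^sub>R steepest_descent_direction M F p))
      \<le> component F i p - \<beta> * s * (rnorm M p (steepest_descent_direction M F p))\<^sup>2"
    unfolding v_def n_def .
qed

section \<open>The complexity bound\<close>

text \<open>Apart from the initial trial, which is long enough (in the adaptive rule by induction, being the
  previous step), a trial step of a backtracking strategy is the
  shrunken form of a rejected one. A rejected step exceeds the threshold below which every step is
  accepted: \<open>1/L\<close> in the adaptive rule, as \<open>\<zeta> \<le> 1/2\<close>, and \<open>2 (1 - \<delta>)/L\<close> in the Armijo-type rule.\<close>

lemma stepsize_decrease:
  fixes F :: "'a \<Rightarrow> real ^ 'm::finite"
  assumes complete: "geodesically_complete M" and F: "continuously_differentiable M F"
    and lip: "componentwise_lipschitz_gradient M F L" and L: "0 < L"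
    and seq: "steepest_descent_sequence M F p v t"
    and rule_cases: "(lipschitz_stepsize L \<epsilon> t \<and> \<nu> = 1/2 \<and> \<xi> = \<epsilon>) \<or>
         (adaptive_stepsize M F L \<zeta> L\<^sub>0 \<eta> p v t \<and> \<nu> = \<zeta> \<and> \<xi> = \<eta> / L) \<or>
         (armijo_stepsize M F L t_min t_max \<omega>\<^sub>1 \<omega>\<^sub>2 \<delta> p v t \<and> \<nu> = \<delta> \<and> \<xi> = t_min)"
  shows "0 < \<nu>" "0 < \<xi>" "sufficient_decrease M F \<nu> (p k) (v k) (t k)" "\<xi> \<le> t k"
proof -
  have small: "sufficient_decrease M F \<beta> (p k) (v k) s" if "0 < s" "s \<le> 2 * (1 - \<beta>) / L" for \<beta> k s
  proof -
    have "v k = steepest_descent_direction M F (p k)"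
      using seq unfolding steepest_descent_sequence_def by blast
    then show ?thesis using small_step_sufficient_decrease[OF complete F lip L that] by simp
  qed
  have t_pos: "0 < t k" for k using seq unfolding steepest_descent_sequence_def by blast
  have "0 < \<nu> \<and> 0 < \<xi> \<and> sufficient_decrease M F \<nu> (p k) (v k) (t k) \<and> \<xi> \<le> t k"
    using rule_cases
  proof (elim disjE conjE)
    assume st: "lipschitz_stepsize L \<epsilon> t" and eq: "\<nu> = 1/2" "\<xi> = \<epsilon>"
    show ?thesis
      unfolding eq
      using small[OF t_pos, of k "1/2" k] st unfolding lipschitz_stepsize_def
      by (auto simp: less_imp_le)
  next
    assume st: "adaptive_stepsize M F L \<zeta> L\<^sub>0 \<eta> p v t" and eq: "\<nu> = \<zeta>" "\<xi> = \<eta> / L"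
    define prev where "prev k = (case k of 0 \<Rightarrow> 1 / L\<^sub>0 | Suc j \<Rightarrow> t j)" for k
    have par: "0 < \<zeta>" "\<zeta> \<le> 1/2" "0 < L\<^sub>0" "L\<^sub>0 \<le> L" "0 < \<eta>" "\<eta> < 1"
      and rule: "\<And>k. \<exists>i::nat. sufficient_decrease M F \<zeta> (p k) (v k) (\<eta> ^ i * prev k) \<and>
               (\<forall>j<i. \<not> sufficient_decrease M F \<zeta> (p k) (v k) (\<eta> ^ j * prev k)) \<and>
               t k = \<eta> ^ i * prev k"
      using st unfolding adaptive_stepsize_def Let_def prev_def by blast+
    have "1 / L \<le> 2 * (1 - \<zeta>) / L" using par L by (intro divide_right_mono) auto
    note accept = small[OF _ order_trans[OF _ this]]
    have prev_pos: "0 < prev k" for k using par t_pos by (auto simp: prev_def split: nat.split)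
    have step: "\<eta> / L \<le> t k" if prev: "\<eta> / L \<le> prev k" for k
    proof -
      obtain i where i: "\<And>j. j < i \<Longrightarrow> \<not> sufficient_decrease M F \<zeta> (p k) (v k) (\<eta> ^ j * prev k)"
        "t k = \<eta> ^ i * prev k"
        using rule[of k] by blast
      show ?thesis
      proof (cases i)
        case 0
        then show ?thesis using i(2) prev by simp
      next
        case (Suc j)
        then have "\<not> \<eta> ^ j * prev k \<le> 1 / L" using i(1)[of j] accept prev_pos[of k] par by auto
        then have "\<eta> * (1 / L) \<le> \<eta> * (\<eta> ^ j * prev k)" using par by (intro mult_left_mono) auto
        then show ?thesis using i(2) Suc by (simp add: mult.assoc)
      qed
    qed
    have "\<eta> / L \<le> t k" for k
    proof (induction k)
      case 0
      have "\<eta> / L \<le> 1 / L" using par L by (intro divide_right_mono) auto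
      also have "\<dots> \<le> 1 / L\<^sub>0" using par by (intro divide_left_mono) auto
      finally show ?case using step[of 0] by (simp add: prev_def)
    next
      case (Suc k)
      then show ?case using step[of "Suc k"] by (simp add: prev_def)
    qed
    then show ?thesis using rule[of k] par L eq by auto
  next
    assume st: "armijo_stepsize M F L t_min t_max \<omega>\<^sub>1 \<omega>\<^sub>2 \<delta> p v t" and eq: "\<nu> = \<delta>" "\<xi> = t_min"
    have par: "0 < t_min" "0 < \<omega>\<^sub>1" "0 < \<delta>" "t_min < 2 * \<omega>\<^sub>1 * (1 - \<delta>) / L"
      using st unfolding armijo_stepsize_def by blast+
    have "\<exists>(s :: nat \<Rightarrow> real) n.
        s 0 \<in> {t_min..t_max} \<and>
        (\<forall>l<n. \<not> sufficient_decrease M F \<delta> (p k) (v k) (s l) \<and>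
               s (Suc l) \<in> {\<omega>\<^sub>1 * s l..\<omega>\<^sub>2 * s l}) \<and>
        sufficient_decrease M F \<delta> (p k) (v k) (s n) \<and> t k = s n"
      using st unfolding armijo_stepsize_def by blast
    then obtain s :: "nat \<Rightarrow> real" and n where s: "t_min \<le> s 0"
        "\<And>l. l < n \<Longrightarrow> \<not> sufficient_decrease M F \<delta> (p k) (v k) (s l)"
        "\<And>l. l < n \<Longrightarrow> \<omega>\<^sub>1 * s l \<le> s (Suc l)"
        "sufficient_decrease M F \<delta> (p k) (v k) (s n)" "t k = s n"
      by auto
    have s_pos: "0 < s l" if "l \<le> n" for l
      using that
    proof (induction l)
      case (Suc l)
      then have "0 < \<omega>\<^sub>1 * s l" using par by simp
      then show ?case using s(3)[of l] Suc.prems by simp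
    qed (use s(1) par in simp)
    have "t_min \<le> s n"
    proof (cases n)
      case 0
      then show ?thesis using s(1) by simp
    next
      case (Suc l)
      have "2 * (1 - \<delta>) / L \<le> s l"
        using s(2)[of l] small[of "s l" \<delta> k] s_pos[of l] Suc by fastforce
      then have "\<omega>\<^sub>1 * (2 * (1 - \<delta>) / L) \<le> \<omega>\<^sub>1 * s l" using par by (intro mult_left_mono) auto
      then show ?thesis using s(3)[of l] Suc par(4) by (simp add: algebra_simps)
    qed
    then show ?thesis using s(4,5) par eq by simp
  qed
  then show "0 < \<nu>" "0 < \<xi>" "sufficient_decrease M F \<nu> (p k) (v k) (t k)" "\<xi> \<le> t k" by auto
qed

end

lemma min_le_sqrt_of_sum_squares:
  fixes x :: "nat \<Rightarrow> real"
  assumes "0 < N" "\<And>k. 0 \<le> x k" "0 < c" "(\<Sum>k<N. c * (x k)\<^sup>2) \<le> D"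
  shows "(MIN k\<in>{..<N}. x k) \<le> sqrt (D / c) * (1 / sqrt (real N))"
proof -
  define \<mu> where "\<mu> = (MIN k\<in>{..<N}. x k)"
  have ne: "{..<N} \<noteq> {}" using assms(1) by auto
  have \<mu>0: "0 \<le> \<mu>" unfolding \<mu>_def using assms(2) ne by (subst Min_ge_iff) auto
  have \<mu>: "\<mu> \<le> x k" if "k < N" for k unfolding \<mu>_def using that by (intro Min_le) auto
  have "real N * (c * \<mu>\<^sup>2) = (\<Sum>k<N. c * \<mu>\<^sup>2)" by simp
  also have "\<dots> \<le> (\<Sum>k<N. c * (x k)\<^sup>2)"
    using \<mu> \<mu>0 assms(3) by (intro sum_mono mult_left_mono power_mono) auto
  also note assms(4)
  finally have "\<mu>\<^sup>2 \<le> D / c / real N" using assms(1,3) by (simp add: field_simps)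
  then have "\<mu> \<le> sqrt (D / c / real N)" by (rule real_le_rsqrt)
  then show ?thesis by (simp add: \<mu>_def real_sqrt_divide real_sqrt_mult)
qed

text \<open>Some gap is finite, hence so is the least one, and a finite gap means a finite infimum. This allows
  one to leave the extended reals.\<close>

lemma optimality_gap_finite:
  fixes F :: "'a \<Rightarrow> real ^ 'm::finite"
  assumes "\<exists>i. (INF q. ereal (component F i q)) > -\<infinity>"
    and "optimality_gap F i_star q0 = (MIN i. optimality_gap F i q0)"
  obtains m where "optimality_gap F i_star q0 = ereal (component F i_star q0 - m)"
    "\<And>q. m \<le> component F i_star q"
proof -
  obtain i where i: "(INF q. ereal (component F i q)) > -\<infinity>" using assms(1) by blast
  have "optimality_gap F i_star q0 \<le> optimality_gap F i q0" unfolding assms(2) by (intro Min_le) auto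
  also have "\<dots> < \<infinity>"
    using i unfolding optimality_gap_def by (cases "INF q. ereal (component F i q)") auto
  finally have fin: "optimality_gap F i_star q0 < \<infinity>" .
  have low: "(INF q. ereal (component F i_star q)) \<le> ereal (component F i_star q)" for q
    by (rule INF_lower) simp
  show ?thesis
  proof (cases "INF q. ereal (component F i_star q)")
    case (real m)
    then show ?thesis using that[of m] low by (simp add: optimality_gap_def)
  next
    case PInf
    then show ?thesis using low[of q0] by simp
  next
    case MInf
    then show ?thesis using fin by (simp add: optimality_gap_def)
  qed
qed

theorem theorem17:
  fixes M :: "('a::{t2_space, second_countable_topology}, 'e::euclidean_space) riem_structure"
    and F :: "'a \<Rightarrow> real ^ 'm::finite"
    and L \<nu> \<xi> \<epsilon> \<zeta> L\<^sub>0 \<eta> t_min t_max \<omega>\<^sub>1 \<omega>\<^sub>2 \<delta> :: real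
    and p :: "nat \<Rightarrow> 'a" and v :: "nat \<Rightarrow> 'e" and t :: "nat \<Rightarrow> real"
    and i_star :: 'm and N :: nat
  assumes "riemannian_manifold M"
    and "connected (UNIV :: 'a set)"
    and "geodesically_complete M"
    and "continuously_differentiable M F"
    and "componentwise_lipschitz_gradient M F L"
    and "0 < L"
    and "steepest_descent_sequence M F p v t"
    and "{q. \<forall>k. F q \<le> F (p k)} \<noteq> {}"
    and "(lipschitz_stepsize L \<epsilon> t \<and> \<nu> = 1/2 \<and> \<xi> = \<epsilon>) \<or>
         (adaptive_stepsize M F L \<zeta> L\<^sub>0 \<eta> p v t \<and> \<nu> = \<zeta> \<and> \<xi> = \<eta> / L) \<or>
         (armijo_stepsize M F L t_min t_max \<omega>\<^sub>1 \<omega>\<^sub>2 \<delta> p v t \<and> \<nu> = \<delta> \<and> \<xi> = t_min)"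
    and "\<exists>i. (INF q. ereal (component F i q)) > -\<infinity>"
    and "optimality_gap F i_star (p 0) = (MIN i. optimality_gap F i (p 0))"
    and "N \<ge> 1"
  shows "(MIN k\<in>{..<N}. rnorm M (p k) (v k))
           \<le> sqrt (real_of_ereal (optimality_gap F i_star (p 0)) / (\<nu> * \<xi>)) * (1 / sqrt (real N))"
proof -
  interpret riemannian M by (rule riemannian.intro) (rule assms(1))
  note step = stepsize_decrease[OF assms(3-7,9)]
  define f where "f = component F i_star"
  obtain m where m: "optimality_gap F i_star (p 0) = ereal (f (p 0) - m)" "\<And>q. m \<le> f q"
    using optimality_gap_finite[OF assms(10,11)] unfolding f_def by blast
  have "\<nu> * \<xi> * (rnorm M (p k) (v k))\<^sup>2 \<le> f (p k) - f (p (Suc k))" for k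
  proof -
    have "\<nu> * \<xi> * (rnorm M (p k) (v k))\<^sup>2 \<le> \<nu> * t k * (rnorm M (p k) (v k))\<^sup>2"
      using step(1) step(4)[of k] by (intro mult_right_mono mult_left_mono) auto
    moreover have "p (Suc k) = exp_map M (p k) (t k *\<^sub>R v k)"
      using assms(7) unfolding steepest_descent_sequence_def by blast
    then have "f (p (Suc k)) \<le> f (p k) - \<nu> * t k * (rnorm M (p k) (v k))\<^sup>2"
      using step(3)[of k] unfolding sufficient_decrease_iff f_def by simp
    ultimately show ?thesis by linarith
  qed
  then have "(\<Sum>k<N. \<nu> * \<xi> * (rnorm M (p k) (v k))\<^sup>2) \<le> (\<Sum>k<N. f (p k) - f (p (Suc k)))"
    by (intro sum_mono)
  also have "\<dots> = f (p 0) - f (p N)" by (rule sum_lessThan_telescope')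
  also have "\<dots> \<le> f (p 0) - m" using m(2)[of "p N"] by simp
  finally have "(MIN k\<in>{..<N}. rnorm M (p k) (v k)) \<le> sqrt ((f (p 0) - m) / (\<nu> * \<xi>)) * (1 / sqrt (real N))"
    using assms(12) step(1,2) rnorm_nonneg by (intro min_le_sqrt_of_sum_squares) auto
  then show ?thesis by (simp add: m(1))
qed

end
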